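(* Let $f_0,f_k:(0,1)\to\mathbb{R}$ and $V_0,V_k:\mathbb{R}^{|\mathcal{K}|}\to\mathbb{R}$ for $k\in\mathbb{K}$. With $\mathcal{R}_c$, $\mathcal{R}_{d^k}$ (affine functions of $(z,\rho)$) and $\mathcal{Q}_M^\alpha(\gamma)$ as defined in the context, consider the problem $$(\mathrm{UB})\qquad\min_{z,\rho}\ z\quad\text{s.t.}\quad f_0(p_0)V_0(\rho)\le\mathcal{R}_c,\quad f_k(p_1)V_k(\rho)\le\mathcal{R}_{d^k}\ \ \forall k\in\mathbb{K},\quad\rho\in\mathcal{Q}_M^\alpha(\gamma).$$ Suppose that $\tilde c^u,\tilde c^l,\tilde d^{ku},\tilde d^{kl}$, $k\in\mathbb{K}$, are known and that $\zeta^u(s'|s,a)\ge0$ and $\zeta^l(s'|s,a)\le0$ for all $(s,a)\in\mathcal{K}$, $s'\in S$. In each of the following two cases, (UB) is a second-order cone programming problem and its optimal value is an upper bound to the optimal value of the problem (JCCMDP) defined in the context. 1. The covariance matrix of the perturbation vector $(\zeta(s'|s,a))_{(s,a)\in\mathcal{K},s'\in S}$ is known, and $f_0(p_0)=\sqrt{\frac{p_0}{1-p_0}}$, $V_0(\rho)=\|\Sigma_{C\zeta}^{1/2}\rho\|_2$, $f_k(p_1)=\sqrt{\frac{K-1+p_1}{1-p_1}}$, $V_k(\rho)=\|\Sigma_{D^k\zeta}^{1/2}\rho\|_2$, where $\Sigma_{C\zeta}$ and $\Sigma_{D^k\zeta}$ are the covariance matrices of the random vectors indexed by $(s,a)\in\mathcal{K}$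 whose $(s,a)$-th components are $\sum_{s'\in S\setminus\{s_c\}}C_{\max}^{s_c}(s')\zeta(s'|s,a)$ and $\sum_{s'\in S\setminus\{s_{d^k}\}}D_{\max}^{k,s_{d^k}}(s')\zeta(s'|s,a)$, respectively. 2. The $|\mathcal{K}|$ random vectors $(\zeta(s'|s,a))_{s'\in S}$, $(s,a)\in\mathcal{K}$, are independent, and $f_0(p_0)=\sqrt{-\frac12\ln(1-p_0)}$, $V_0(\rho)=\|\mathcal{D}_{C\zeta}^{1/2}\rho\|_2$, $f_k(p_1)=\sqrt{-\frac12\ln\frac{1-p_1}{K}}$, $V_k(\rho)=\|\mathcal{D}_{D^k\zeta}^{1/2}\rho\|_2$, where $\mathcal{D}_{C\zeta}$, $\mathcal{D}_{D^k\zeta}$ are the $|\mathcal{K}|\times|\mathcal{K}|$ diagonal matrices with $(s,a)$-th diagonal entries $$\Big(\sum_{s'\in S\setminus\{s_c\}}C_{\max}^{s_c}(s')\big(\zeta^u(s'|s,a)-\zeta^l(s'|s,a)\big)\Big)^2,\qquad \Big(\sum_{s'\in S\setminus\{s_{d^k}\}}D_{\max}^{k,s_{d^k}}(s')\big(\zeta^u(s'|s,a)-\zeta^l(s'|s,a)\big)\Big)^2.$$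
   Context: Setting. $S$ is a finite nonempty state space, $A(s)$ a finite nonempty action set for each $s\in S$, $\mathcal{K}=\{(s,a):s\in S,a\in A(s)\}$, $\alpha\in(0,1)$, $\gamma$ a probability distribution on $S$, $\mathbb{K}=\{1,\dots,K\}$, $\xi_k\in\mathbb{R}$, $p_0,p_1\in(0,1)$. On a probability space $(\Omega,\mathcal{F},\mathbb{P})$ there are random running costs $\tilde c(s,a)$, $\tilde d^k(s,a)$ and random transition probabilities $\tilde p(s'|s,a)(\omega)=\mu(s'|s,a)+\zeta(s'|s,a)(\omega)$, where $\mu(s'|s,a)=\mathbb{E}\,\tilde p(s'|s,a)$; for every $\omega$, both $\tilde p(\cdot|s,a)(\omega)$ and $\mu(\cdot|s,a)$ are probability distributions on $S$ (hence $\sum_{s'}\zeta(s'|s,a)(\omega)=0$, $\mathbb{E}\zeta(s'|s,a)=0$). Bounds, valid for all $\omega$: $\tilde c^l\le\tilde c\le\tilde c^u$, $\tilde d^{kl}\le\tilde d^k\le\tilde d^{ku}$ componentwise, and $\zeta^l(s'|s,a)\le\zeta(s'|s,a)\le\zeta^u(s'|s,a)$. Stationary policies: $F_S$ is the set of $f=(f(s))_{s\in S}$ with $f(s)=(f(s,a))_{a\in A(s)}$ a probability distribution on $A(s)$. For $f\in F_S$: $\tilde c_f(s)=\sum_{a}f(s,a)\tilde c(s,a)$, $\tilde d^k_f(s)=\sum_a f(s,a)\tilde d^k(s,a)$, $\tilde P_f(\omega)$ is the matrix with $(s,s')$ entry $\sum_a f(s,a)\tilde p(s'|s,a)(\omega)$,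 $\tilde Q_f(\omega)=(I-\alpha\tilde P_f(\omega))^{-1}$, and the random expected discounted costs are $\tilde C(\gamma,f)=(1-\alpha)\gamma^T\tilde Q_f\tilde c_f$, $\tilde D^k(\gamma,f)=(1-\alpha)\gamma^T\tilde Q_f\tilde d^k_f$. The problem considered is $$(\mathrm{JCCMDP})\quad\min_{z\in\mathbb{R},f\in F_S}z\ \ \text{s.t.}\ \ \mathbb{P}\big(\tilde C(\gamma,f)\le z\big)\ge p_0,\quad\mathbb{P}\big(\tilde D^k(\gamma,f)\le\xi_k\ \forall k\in\mathbb{K}\big)\ge p_1.$$ Notation. $c_{\max}=\max_{\mathcal{K}}\tilde c^u(s,a)$, $c_{\min}=\min_{\mathcal{K}}\tilde c^l(s,a)$, $d^k_{\max}=\max_{\mathcal{K}}\tilde d^{ku}(s,a)$, $d^k_{\min}=\min_{\mathcal{K}}\tilde d^{kl}(s,a)$; $C_{\max}(s)=\max_{a\in A(s)}\tilde c^u(s,a)+\frac{\alpha}{1-\alpha}c_{\max}$, $C_{\min}(s)=\min_{a\in A(s)}\tilde c^l(s,a)+\frac{\alpha}{1-\alpha}c_{\min}$, $D^k_{\max}(s)=\max_{a\in A(s)}\tilde d^{ku}(s,a)+\frac{\alpha}{1-\alpha}d^k_{\max}$, $D^k_{\min}(s)=\min_{a\in A(s)}\tilde d^{kl}(s,a)+\frac{\alpha}{1-\alpha}d^k_{\min}$. Fix $s_c\in\arg\min_{s'}C_{\max}(s')$, $s_{d^k}\in\arg\min_{s'}D^k_{\max}(s')$, and put $C_{\max}^{s_c}(s')=C_{\max}(s')-C_{\max}(s_c)$,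 $D_{\max}^{k,s_{d^k}}(s')=D^k_{\max}(s')-D^k_{\max}(s_{d^k})$. Define $\mathcal{R}_c,\mathcal{R}_{d^k}$ by $$\alpha\mathcal{R}_c=z-\rho^T\tilde c^u+\alpha\sum_{(s,a)\in\mathcal{K}}\sum_{s'\in S}\rho(s,a)\big(C_{\max}(s')-C_{\min}(s')\big)\zeta^l(s'|s,a),$$ $$\alpha\mathcal{R}_{d^k}=\xi_k-\rho^T\tilde d^{ku}+\alpha\sum_{(s,a)\in\mathcal{K}}\sum_{s'\in S}\rho(s,a)\big(D^k_{\max}(s')-D^k_{\min}(s')\big)\zeta^l(s'|s,a).$$ $\mathcal{Q}_M^\alpha(\gamma)$ is the set of $\rho\in\mathbb{R}^{|\mathcal{K}|}$ with $\rho\ge0$ and $\sum_{(s,a)\in\mathcal{K}}\rho(s,a)(\delta(s',s)-\alpha\mu(s'|s,a))=(1-\alpha)\gamma(s')$ for all $s'\in S$, with $\delta$ the Kronecker delta. $\Sigma^{1/2}$ denotes the symmetric positive semidefinite square root. The optimal value of a minimization problem is the infimum of its objective over its feasible set ($+\infty$ if infeasible). *)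

theory Defs
  imports "HOL-Probability.Probability"
begin

text \<open>
  States are the elements of a finite type; \<open>A s\<close> is the action set of state \<open>s\<close>.
  A vector indexed by a finite set \<open>I\<close> is a function of which only the values on \<open>I\<close> are ever
  used; the values outside \<open>I\<close> are unconstrained and irrelevant.
\<close>

definition state_actions :: "('s \<Rightarrow> 'a set) \<Rightarrow> ('s \<times> 'a) set" where
  "state_actions A = Sigma UNIV A"

definition prob_dist_on :: "'b set \<Rightarrow> ('b \<Rightarrow> real) \<Rightarrow> bool" where
  "prob_dist_on B q \<longleftrightarrow> (\<forall>b\<in>B. 0 \<le> q b) \<and> (\<Sum>b\<in>B. q b) = 1"

definition stationary_policies :: "('s \<Rightarrow> 'a set) \<Rightarrow> ('s \<Rightarrow> 'a \<Rightarrow> real) set" where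
  "stationary_policies A = {f. \<forall>s. prob_dist_on (A s) (f s)}"

definition policy_matrix ::
  "('s::finite \<Rightarrow> 'a set) \<Rightarrow> ('s \<Rightarrow> 'a \<Rightarrow> real) \<Rightarrow> ('s \<times> 'a \<Rightarrow> 's \<Rightarrow> real) \<Rightarrow> real^'s^'s" where
  "policy_matrix A f P = (\<chi> s s'. \<Sum>a\<in>A s. f s a * P (s, a) s')"

definition policy_cost ::
  "('s::finite \<Rightarrow> 'a set) \<Rightarrow> ('s \<Rightarrow> 'a \<Rightarrow> real) \<Rightarrow> ('s \<times> 'a \<Rightarrow> real) \<Rightarrow> real^'s" where
  "policy_cost A f g = (\<chi> s. \<Sum>a\<in>A s. f s a * g (s, a))"

text \<open>Here \<open>P\<close> and \<open>g\<close> are the transition law and the running cost at one fixed outcome.\<close>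

definition discounted_cost ::
  "('s::finite \<Rightarrow> 'a set) \<Rightarrow> real \<Rightarrow> real^'s \<Rightarrow> ('s \<Rightarrow> 'a \<Rightarrow> real) \<Rightarrow>
   ('s \<times> 'a \<Rightarrow> 's \<Rightarrow> real) \<Rightarrow> ('s \<times> 'a \<Rightarrow> real) \<Rightarrow> real" where
  "discounted_cost A \<alpha> \<gamma> f P g =
     (1 - \<alpha>) * (\<gamma> \<bullet> (matrix_inv (mat 1 - \<alpha> *\<^sub>R policy_matrix A f P) *v policy_cost A f g))"

definition jccmdp_feasible ::
  "'w measure \<Rightarrow> ('s::finite \<Rightarrow> 'a set) \<Rightarrow> real \<Rightarrow> real^'s \<Rightarrow> nat \<Rightarrow> (nat \<Rightarrow> real) \<Rightarrow> real \<Rightarrow> real \<Rightarrow>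
   ('s \<times> 'a \<Rightarrow> 'w \<Rightarrow> real) \<Rightarrow> (nat \<Rightarrow> 's \<times> 'a \<Rightarrow> 'w \<Rightarrow> real) \<Rightarrow> ('s \<times> 'a \<Rightarrow> 's \<Rightarrow> 'w \<Rightarrow> real) \<Rightarrow>
   (real \<times> ('s \<Rightarrow> 'a \<Rightarrow> real)) set" where
  "jccmdp_feasible M A \<alpha> \<gamma> K \<xi> p0 p1 c d p = {(z, f). f \<in> stationary_policies A \<and>
     measure M {\<omega> \<in> space M.
       discounted_cost A \<alpha> \<gamma> f (\<lambda>k s'. p k s' \<omega>) (\<lambda>k. c k \<omega>) \<le> z} \<ge> p0 \<and>
     measure M {\<omega> \<in> space M. \<forall>j\<in>{1..K}.
       discounted_cost A \<alpha> \<gamma> f (\<lambda>k s'. p k s' \<omega>) (\<lambda>k. d j k \<omega>) \<le> \<xi> j} \<ge> p1}"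

text \<open>The infimum over an empty feasible set is \<open>\<infinity>\<close>.\<close>

definition opt_value :: "('x \<Rightarrow> real) \<Rightarrow> 'x set \<Rightarrow> ereal" where
  "opt_value obj F = (INF x\<in>F. ereal (obj x))"

text \<open>
  \<open>C\<^sub>m\<^sub>a\<^sub>x\<close> and \<open>C\<^sub>m\<^sub>i\<^sub>n\<close> as functions of the state, for a cost with upper bound \<open>u\<close> and
  lower bound \<open>l\<close>; also used for the constraint costs.
\<close>

definition cost_max :: "('s \<Rightarrow> 'a set) \<Rightarrow> real \<Rightarrow> ('s \<times> 'a \<Rightarrow> real) \<Rightarrow> 's \<Rightarrow> real" where
  "cost_max A \<alpha> u s =
     Max ((\<lambda>a. u (s, a)) ` A s) + \<alpha> / (1 - \<alpha>) * Max (u ` state_actions A)"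

definition cost_min :: "('s \<Rightarrow> 'a set) \<Rightarrow> real \<Rightarrow> ('s \<times> 'a \<Rightarrow> real) \<Rightarrow> 's \<Rightarrow> real" where
  "cost_min A \<alpha> l s =
     Min ((\<lambda>a. l (s, a)) ` A s) + \<alpha> / (1 - \<alpha>) * Min (l ` state_actions A)"

text \<open>
  The affine right-hand side \<open>R\<close>, determined by
  \<open>\<alpha> R = b - \<rho>\<^sup>T u + \<alpha> \<Sum>\<^sub>k \<Sum>\<^sub>s\<^sub>' \<rho>\<^sub>k (C\<^sub>m\<^sub>a\<^sub>x s' - C\<^sub>m\<^sub>i\<^sub>n s') \<zeta>l k s'\<close>.
\<close>

definition residual ::
  "('s::finite \<Rightarrow> 'a set) \<Rightarrow> real \<Rightarrow> ('s \<times> 'a \<Rightarrow> real) \<Rightarrow> ('s \<times> 'a \<Rightarrow> real) \<Rightarrow>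
   ('s \<times> 'a \<Rightarrow> 's \<Rightarrow> real) \<Rightarrow> real \<Rightarrow> ('s \<times> 'a \<Rightarrow> real) \<Rightarrow> real" where
  "residual A \<alpha> l u \<zeta>l b \<rho> =
     (b - (\<Sum>k\<in>state_actions A. \<rho> k * u k)
        + \<alpha> * (\<Sum>k\<in>state_actions A. \<Sum>s'\<in>UNIV.
                 \<rho> k * (cost_max A \<alpha> u s' - cost_min A \<alpha> l s') * \<zeta>l k s')) / \<alpha>"

text \<open>\<open>fst k\<close> is the state of the state-action pair \<open>k\<close>.\<close>

definition occupation_polytope ::
  "('s::finite \<Rightarrow> 'a set) \<Rightarrow> real \<Rightarrow> ('s \<times> 'a \<Rightarrow> 's \<Rightarrow> real) \<Rightarrow> real^'s \<Rightarrow> ('s \<times> 'a \<Rightarrow> real) set" where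
  "occupation_polytope A \<alpha> \<mu> \<gamma> = {\<rho>. (\<forall>k\<in>state_actions A. 0 \<le> \<rho> k) \<and>
     (\<forall>s'. (\<Sum>k\<in>state_actions A. \<rho> k * ((if s' = fst k then 1 else 0) - \<alpha> * \<mu> k s'))
            = (1 - \<alpha>) * (\<gamma> $ s'))}"

definition ub_feasible ::
  "('s::finite \<Rightarrow> 'a set) \<Rightarrow> real \<Rightarrow> real^'s \<Rightarrow> nat \<Rightarrow> (nat \<Rightarrow> real) \<Rightarrow> real \<Rightarrow> real \<Rightarrow>
   ('s \<times> 'a \<Rightarrow> 's \<Rightarrow> real) \<Rightarrow> ('s \<times> 'a \<Rightarrow> real) \<Rightarrow> ('s \<times> 'a \<Rightarrow> real) \<Rightarrow>
   (nat \<Rightarrow> 's \<times> 'a \<Rightarrow> real) \<Rightarrow> (nat \<Rightarrow> 's \<times> 'a \<Rightarrow> real) \<Rightarrow> ('s \<times> 'a \<Rightarrow> 's \<Rightarrow> real) \<Rightarrow>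
   (real \<Rightarrow> real) \<Rightarrow> (('s \<times> 'a \<Rightarrow> real) \<Rightarrow> real) \<Rightarrow>
   (nat \<Rightarrow> real \<Rightarrow> real) \<Rightarrow> (nat \<Rightarrow> ('s \<times> 'a \<Rightarrow> real) \<Rightarrow> real) \<Rightarrow>
   (real \<times> ('s \<times> 'a \<Rightarrow> real)) set" where
  "ub_feasible A \<alpha> \<gamma> K \<xi> p0 p1 \<mu> cl cu dl du \<zeta>l f0 V0 fd Vd = {(z, \<rho>).
     f0 p0 * V0 \<rho> \<le> residual A \<alpha> cl cu \<zeta>l z \<rho> \<and>
     (\<forall>j\<in>{1..K}. fd j p1 * Vd j \<rho> \<le> residual A \<alpha> (dl j) (du j) \<zeta>l (\<xi> j) \<rho>) \<and>
     \<rho> \<in> occupation_polytope A \<alpha> \<mu> \<gamma>}"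

definition linear_form :: "'i set \<Rightarrow> (('i \<Rightarrow> real) \<Rightarrow> real) \<Rightarrow> bool" where
  "linear_form I g \<longleftrightarrow> (\<exists>a. \<forall>x. g x = (\<Sum>i\<in>I. a i * x i))"

definition affine_form :: "'i set \<Rightarrow> (('i \<Rightarrow> real) \<Rightarrow> real) \<Rightarrow> bool" where
  "affine_form I g \<longleftrightarrow> (\<exists>a b. \<forall>x. g x = (\<Sum>i\<in>I. a i * x i) + b)"

text \<open>
  A second-order cone constraint \<open>\<parallel>G x + h\<parallel>\<^sub>2 \<le> g\<^sup>T x + e\<close>, where \<open>y r x\<close> is the \<open>r\<close>-th component of
  \<open>G x + h\<close>. For \<open>m = 0\<close> it is a linear inequality.
\<close>

definition soc_constraint :: "'i set \<Rightarrow> ('i \<Rightarrow> real) set \<Rightarrow> bool" where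
  "soc_constraint I C \<longleftrightarrow> (\<exists>(m::nat) y t. (\<forall>r<m. affine_form I (y r)) \<and> affine_form I t \<and>
     C = {x. L2_set (\<lambda>r. y r x) {..<m} \<le> t x})"

definition linear_equality :: "'i set \<Rightarrow> ('i \<Rightarrow> real) set \<Rightarrow> bool" where
  "linear_equality I C \<longleftrightarrow> (\<exists>g. affine_form I g \<and> C = {x. g x = 0})"

definition is_socp :: "'i set \<Rightarrow> (('i \<Rightarrow> real) \<Rightarrow> real) \<Rightarrow> ('i \<Rightarrow> real) set \<Rightarrow> bool" where
  "is_socp I obj F \<longleftrightarrow> finite I \<and> linear_form I obj \<and>
     (\<exists>CC. finite CC \<and> (\<forall>C\<in>CC. soc_constraint I C \<or> linear_equality I C) \<and> F = \<Inter>CC)"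

text \<open>
  The problem of minimizing \<open>z\<close> over pairs \<open>(z, \<rho>)\<close> in \<open>F\<close>, with \<open>\<rho>\<close> indexed by \<open>J\<close>, is viewed as a
  problem in the single vector \<open>x\<close> with \<open>x None = z\<close> and \<open>x (Some k) = \<rho> k\<close>.
\<close>

definition is_socp_pair :: "'j set \<Rightarrow> (real \<times> ('j \<Rightarrow> real)) set \<Rightarrow> bool" where
  "is_socp_pair J F \<longleftrightarrow> is_socp (insert None (Some ` J)) (\<lambda>x. x None) {x. (x None, \<lambda>k. x (Some k)) \<in> F}"

definition covariance_matrix :: "'w measure \<Rightarrow> ('i \<Rightarrow> 'w \<Rightarrow> real) \<Rightarrow> 'i \<Rightarrow> 'i \<Rightarrow> real" where
  "covariance_matrix M X i j =
     (LINT \<omega>|M. (X i \<omega> - integral\<^sup>L M (X i)) * (X j \<omega> - integral\<^sup>L M (X j)))"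

definition diagonal_matrix :: "('i \<Rightarrow> real) \<Rightarrow> 'i \<Rightarrow> 'i \<Rightarrow> real" where
  "diagonal_matrix v i j = (if i = j then v i else 0)"

definition symmetric_psd_on :: "'i set \<Rightarrow> ('i \<Rightarrow> 'i \<Rightarrow> real) \<Rightarrow> bool" where
  "symmetric_psd_on I B \<longleftrightarrow> (\<forall>i\<in>I. \<forall>j\<in>I. B i j = B j i) \<and>
     (\<forall>x. 0 \<le> (\<Sum>i\<in>I. \<Sum>j\<in>I. x i * B i j * x j))"

text \<open>
  For \<open>\<Sigma>\<close> symmetric positive semidefinite on a finite set \<open>I\<close>, the choice is unique on \<open>I \<times> I\<close>.
\<close>

definition psd_sqrt :: "'i set \<Rightarrow> ('i \<Rightarrow> 'i \<Rightarrow> real) \<Rightarrow> 'i \<Rightarrow> 'i \<Rightarrow> real" where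
  "psd_sqrt I \<Sigma> = (SOME B. symmetric_psd_on I B \<and>
     (\<forall>i\<in>I. \<forall>j\<in>I. (\<Sum>k\<in>I. B i k * B k j) = \<Sigma> i j))"

definition psd_sqrt_norm :: "'i set \<Rightarrow> ('i \<Rightarrow> 'i \<Rightarrow> real) \<Rightarrow> ('i \<Rightarrow> real) \<Rightarrow> real" where
  "psd_sqrt_norm I \<Sigma> \<rho> = L2_set (\<lambda>i. \<Sum>j\<in>I. psd_sqrt I \<Sigma> i j * \<rho> j) I"

text \<open>The sum \<open>\<Sum>\<^sub>s\<^sub>' (W s' - W s0) * y s'\<close> over all \<open>s' \<noteq> s0\<close>.\<close>

definition shifted_sum :: "('s::finite \<Rightarrow> real) \<Rightarrow> 's \<Rightarrow> ('s \<Rightarrow> real) \<Rightarrow> real" where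
  "shifted_sum W s0 y = (\<Sum>s'\<in>UNIV - {s0}. (W s' - W s0) * y s')"

end

theory Submission
  imports Defs "HOL-Computational_Algebra.Formal_Power_Series"
begin

text \<open>
  A feasible \<open>\<rho>\<close> of the conic problem is an occupation measure of the mean transition law
  \<open>\<mu>\<close>. Dividing \<open>\<rho>\<close> by its state marginal \<open>r\<close> gives a stationary policy \<open>f\<close> with
  \<open>\<rho>(s,a) = r(s) f(s,a)\<close>, and the polytope equations say
  \<open>r\<^sup>T (I - \<alpha> P\<^sub>\<mu>) = (1 - \<alpha>) \<gamma>\<^sup>T\<close>. At one outcome let \<open>V\<close> be the solution of the Bellman equation
  \<open>V = g\<^sub>f + \<alpha> P\<^sub>f V\<close> for the random law \<open>P = \<mu> + \<zeta>\<close>. Pairing the polytope equations with \<open>V\<close> gives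
  the exact formula
  \<open>(1 - \<alpha>) \<gamma>\<^sup>T V = \<Sum>\<^sub>k \<rho>\<^sub>k (g\<^sub>k + \<alpha> \<Sum>\<^sub>s\<^sub>' \<zeta>\<^sub>k(s') V(s'))\<close>
  (\<open>discounted_cost_occupation\<close>), in which \<open>V\<close> is the only remaining nonlinear dependence on \<open>\<zeta>\<close>.

  The value satisfies \<open>C\<^sub>m\<^sub>i\<^sub>n \<le> V \<le> C\<^sub>m\<^sub>a\<^sub>x\<close>. Replacing \<open>V\<close> by \<open>C\<^sub>m\<^sub>a\<^sub>x\<close> costs
  \<open>- \<zeta> (C\<^sub>m\<^sub>a\<^sub>x - V) \<le> - \<zeta>l (C\<^sub>m\<^sub>a\<^sub>x - C\<^sub>m\<^sub>i\<^sub>n)\<close>, a deterministic amount which is exactly the correction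
  term of the residual. Hence the cost stays below its bound \<open>b\<close> as soon as the linear statistic
  \<open>\<Sum>\<^sub>k \<rho>\<^sub>k \<Sum>\<^sub>s\<^sub>' \<zeta>\<^sub>k(s') C\<^sub>m\<^sub>a\<^sub>x(s')\<close> is at most the residual (\<open>discounted_cost_le\<close>). Since \<open>\<zeta>\<^sub>k\<close> sums to
  zero, \<open>C\<^sub>m\<^sub>a\<^sub>x\<close> may be shifted by its minimum, which makes the weights nonnegative.

  That statistic is centred, so the conic constraint is a sufficient tail condition: with the covariance
  matrix this is the one-sided Chebyshev (Cantelli) inequality, with independent vectors it is
  Hoeffding's inequality. The \<open>K\<close> constraints on the \<open>d\<close>-costs are each required at level
  \<open>1 - (1 - p1) / K\<close> and joined by the union bound. So every feasible \<open>(z, \<rho>)\<close> yields a feasible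
  \<open>(z, f)\<close> with the same objective.

  Two supporting facts are needed. The norms \<open>\<parallel>\<Sigma>\<^sup>1\<^sup>/\<^sup>2 \<rho>\<parallel>\<close> have the value
  \<open>\<surd>(\<rho>\<^sup>T \<Sigma> \<rho>)\<close> only because a positive semidefinite square root exists; it is built from the binomial
  series of \<open>\<surd>(1 - x)\<close>. The costs must be measurable in the outcome; this follows from Cramer's rule.
\<close>

section \<open>The binomial series of the square root\<close>

text \<open>The coefficients of \<open>\<surd>(1 - x)\<close>.\<close>

definition sqrt_coeff :: "nat \<Rightarrow> real" where
  "sqrt_coeff n = (-1) ^ n * ((1/2) gchoose n)"

lemma sqrt_coeff_0: "sqrt_coeff 0 = 1"
  by (simp add: sqrt_coeff_def)

lemma sqrt_coeff_nonpos: "sqrt_coeff (Suc n) \<le> 0"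
proof -
  have "sqrt_coeff (Suc n) = pochhammer (- (1/2)) (Suc n) / fact (Suc n)"
    unfolding sqrt_coeff_def gbinomial_pochhammer by (simp flip: power_add mult_2)
  also have "pochhammer (- (1/2)) (Suc n) = - (1/2) * pochhammer (1/2 :: real) n"
    by (simp add: pochhammer_rec)
  finally show ?thesis
    using pochhammer_nonneg[of "1/2::real" n] by (simp add: divide_nonpos_pos del: fact_Suc)
qed

text \<open>
  By the alternating row sum of binomial coefficients, the partial sums are, up to sign, coefficients
  of \<open>(1 - x)\<^bsup>-1/2\<^esup>\<close>, which are nonnegative.
\<close>

lemma sqrt_coeff_partial_sums_nonneg: "0 \<le> (\<Sum>k\<le>m. sqrt_coeff k)"
proof -
  have "(\<Sum>k\<le>m. sqrt_coeff k) = (-1) ^ m * ((1/2 - 1) gchoose m)"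
    unfolding sqrt_coeff_def by (subst gbinomial_sum_lower_neg[symmetric]) (simp add: mult.commute)
  also have "\<dots> = pochhammer (1/2) m / fact m"
    unfolding gbinomial_pochhammer by (simp flip: power_add mult_2)
  finally show ?thesis
    using pochhammer_nonneg[of "1/2::real" m] by simp
qed

text \<open>
  Only the leading coefficient is positive, so the absolute sums are controlled by the signed ones.
  This puts the point \<open>x = 1\<close> inside the region of absolute convergence, which is needed for singular
  matrices.
\<close>

lemma summable_abs_sqrt_coeff: "summable (\<lambda>n. \<bar>sqrt_coeff n\<bar>)"
proof (rule summableI_nonneg_bounded)
  fix n
  have "(\<Sum>i<n. \<bar>sqrt_coeff i\<bar>) \<le> (\<Sum>i\<le>n. \<bar>sqrt_coeff i\<bar>)"
    by (intro sum_mono2) auto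
  also have "\<dots> = (\<Sum>i\<le>n. (if i = 0 then 2 else 0) - sqrt_coeff i)"
    using sqrt_coeff_nonpos by (intro sum.cong) (auto simp: sqrt_coeff_0 gr0_conv_Suc)
  also have "\<dots> = 2 - (\<Sum>i\<le>n. sqrt_coeff i)"
    by (simp add: sum_subtractf)
  finally show "(\<Sum>i<n. \<bar>sqrt_coeff i\<bar>) \<le> 2"
    using sqrt_coeff_partial_sums_nonneg[of n] by simp
qed simp

lemma summable_sqrt_coeff: "summable sqrt_coeff"
  using summable_abs_sqrt_coeff by (rule summable_rabs_cancel)

lemma suminf_sqrt_coeff_nonneg: "0 \<le> (\<Sum>n. sqrt_coeff n)"
  by (rule LIMSEQ_le_const[OF summable_LIMSEQ'[OF summable_sqrt_coeff]])
     (use sqrt_coeff_partial_sums_nonneg in auto)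

text \<open>
  The coefficientwise form of \<open>\<surd>(1 - x) * \<surd>(1 - x) = 1 - x\<close>, from the Vandermonde identity.
\<close>

lemma sqrt_coeff_convolution:
  "(\<Sum>k\<le>n. sqrt_coeff k * sqrt_coeff (n - k)) = (if n = 0 then 1 else if n = 1 then - 1 else 0)"
proof -
  have "(\<Sum>k\<le>n. sqrt_coeff k * sqrt_coeff (n - k))
      = (\<Sum>k\<le>n. (-1) ^ n * (((1/2) gchoose k) * ((1/2) gchoose (n - k))))"
    by (intro sum.cong) (auto simp: sqrt_coeff_def simp flip: power_add)
  also have "\<dots> = (-1) ^ n * (1 gchoose n)"
    using gbinomial_Vandermonde[of "1/2::real" "1/2" n]
    by (simp add: sum_distrib_left[symmetric] atMost_atLeast0)
  also have "\<dots> = (if n = 0 then 1 else if n = 1 then - 1 else 0)"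
    using binomial_gbinomial[of 1 n, where 'a=real]
    by (cases n) (auto simp: binomial_eq_0)
  finally show ?thesis .
qed

section \<open>Positive semidefinite square roots\<close>

definition mat_vec :: "'i set \<Rightarrow> ('i \<Rightarrow> 'i \<Rightarrow> real) \<Rightarrow> ('i \<Rightarrow> real) \<Rightarrow> 'i \<Rightarrow> real" where
  "mat_vec I B x i = (\<Sum>j\<in>I. B i j * x j)"

definition quad_form :: "'i set \<Rightarrow> ('i \<Rightarrow> 'i \<Rightarrow> real) \<Rightarrow> ('i \<Rightarrow> real) \<Rightarrow> real" where
  "quad_form I B x = (\<Sum>i\<in>I. \<Sum>j\<in>I. x i * B i j * x j)"

primrec mat_power :: "'i set \<Rightarrow> ('i \<Rightarrow> 'i \<Rightarrow> real) \<Rightarrow> nat \<Rightarrow> 'i \<Rightarrow> 'i \<Rightarrow> real" where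
  "mat_power I B 0 i j = (if i = j then 1 else 0)"
| "mat_power I B (Suc n) i j = (\<Sum>k\<in>I. B i k * mat_power I B n k j)"

lemma quad_form_mat_vec: "quad_form I B x = (\<Sum>i\<in>I. x i * mat_vec I B x i)"
  by (simp add: quad_form_def mat_vec_def sum_distrib_left mult.assoc)

lemma mat_power_add:
  assumes "finite I" "i \<in> I"
  shows "mat_power I B (m + n) i j = (\<Sum>k\<in>I. mat_power I B m i k * mat_power I B n k j)"
  using assms(2)
proof (induction m arbitrary: i)
  case 0
  then show ?case using assms(1) by (simp add: mult_delta_left)
next
  case (Suc m)
  have "mat_power I B (Suc m + n) i j
      = (\<Sum>l\<in>I. \<Sum>k\<in>I. B i l * (mat_power I B m l k * mat_power I B n k j))"
    using Suc by (simp add: sum_distrib_left)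
  also have "\<dots> = (\<Sum>k\<in>I. \<Sum>l\<in>I. B i l * (mat_power I B m l k * mat_power I B n k j))"
    by (rule sum.swap)
  finally show ?case
    by (simp add: sum_distrib_right mult.assoc)
qed

lemma mat_power_1: "finite I \<Longrightarrow> j \<in> I \<Longrightarrow> mat_power I B 1 i j = B i j"
  by (simp add: mult_delta_right)

lemma mat_power_sym:
  assumes "finite I" and sym: "\<And>i j. i \<in> I \<Longrightarrow> j \<in> I \<Longrightarrow> B i j = B j i"
    and "i \<in> I" "j \<in> I"
  shows "mat_power I B n i j = mat_power I B n j i"
  using assms(3,4)
proof (induction n arbitrary: i j)
  case (Suc n)
  have "mat_power I B (Suc n) i j = (\<Sum>k\<in>I. mat_power I B n j k * B k i)"
    using Suc sym by (auto intro!: sum.cong)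
  also have "\<dots> = mat_power I B (n + 1) j i"
    using mat_power_add[OF assms(1) \<open>j \<in> I\<close>, of B n 1 i] mat_power_1[OF assms(1) \<open>i \<in> I\<close>, of B]
    by simp
  finally show ?case by simp
qed simp

text \<open>
  Moving one factor \<open>B\<close> to each side of the form: \<open>x\<^sup>T B\<^sup>n\<^sup>+\<^sup>2 x = (B x)\<^sup>T B\<^sup>n (B x)\<close>.
\<close>

lemma quad_form_mat_power_add2:
  assumes "finite I" and sym: "\<And>i j. i \<in> I \<Longrightarrow> j \<in> I \<Longrightarrow> B i j = B j i"
  shows "quad_form I (mat_power I B (Suc (Suc n))) x = quad_form I (mat_power I B n) (mat_vec I B x)"
proof -
  have two: "mat_power I B (Suc (Suc n)) i j = (\<Sum>k\<in>I. \<Sum>l\<in>I. B k i * mat_power I B n k l * B l j)"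
    if "i \<in> I" "j \<in> I" for i j
  proof -
    have "mat_power I B (Suc (Suc n)) i j = (\<Sum>k\<in>I. B i k * mat_power I B (n + 1) k j)"
      by simp
    also have "\<dots> = (\<Sum>k\<in>I. \<Sum>l\<in>I. B k i * mat_power I B n k l * B l j)"
      using that assms
      by (intro sum.cong refl) (simp only: mat_power_add[OF assms(1)] mat_power_1 sum_distrib_left mult.assoc)
    finally show ?thesis .
  qed
  have "quad_form I (mat_power I B (Suc (Suc n))) x
      = (\<Sum>i\<in>I. \<Sum>j\<in>I. \<Sum>k\<in>I. \<Sum>l\<in>I. x i * (B k i * mat_power I B n k l * B l j) * x j)"
    unfolding quad_form_def
    by (intro sum.cong refl) (simp only: two sum_distrib_left sum_distrib_right)
  also have "\<dots> = (\<Sum>i\<in>I. \<Sum>k\<in>I. \<Sum>j\<in>I. \<Sum>l\<in>I. x i * (B k i * mat_power I B n k l * B l j) * x j)"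
    by (intro sum.cong refl sum.swap)
  also have "\<dots> = (\<Sum>k\<in>I. \<Sum>i\<in>I. \<Sum>j\<in>I. \<Sum>l\<in>I. x i * (B k i * mat_power I B n k l * B l j) * x j)"
    by (rule sum.swap)
  also have "\<dots> = (\<Sum>k\<in>I. \<Sum>i\<in>I. \<Sum>l\<in>I. \<Sum>j\<in>I. x i * (B k i * mat_power I B n k l * B l j) * x j)"
    by (intro sum.cong refl sum.swap)
  also have "\<dots> = (\<Sum>k\<in>I. \<Sum>l\<in>I. \<Sum>i\<in>I. \<Sum>j\<in>I. x i * (B k i * mat_power I B n k l * B l j) * x j)"
    by (intro sum.cong refl sum.swap)
  also have "\<dots> = quad_form I (mat_power I B n) (mat_vec I B x)"
    unfolding quad_form_def mat_vec_def
    by (intro sum.cong refl) (simp add: sum_distrib_left sum_distrib_right mult_ac)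
  finally show ?thesis .
qed

definition sq_norm_on :: "'i set \<Rightarrow> ('i \<Rightarrow> real) \<Rightarrow> real" where
  "sq_norm_on I x = (\<Sum>i\<in>I. (x i)\<^sup>2)"

lemma quad_form_mat_power_0: "finite I \<Longrightarrow> quad_form I (mat_power I B 0) x = sq_norm_on I x"
  by (simp add: quad_form_mat_vec mat_vec_def sq_norm_on_def power2_eq_square mult_delta_left)

lemma quad_form_mat_power_1: "finite I \<Longrightarrow> quad_form I (mat_power I B 1) x = quad_form I B x"
  by (simp add: quad_form_def mult_delta_right)

lemma sq_norm_on_nonneg: "0 \<le> sq_norm_on I x"
  by (simp add: sq_norm_on_def sum_nonneg)

lemma bilinear_sym:
  assumes "\<And>i j. i \<in> I \<Longrightarrow> j \<in> I \<Longrightarrow> B i j = B j i"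
  shows "(\<Sum>i\<in>I. y i * mat_vec I B x i) = (\<Sum>i\<in>I. x i * mat_vec I B y i)"
proof -
  have "(\<Sum>i\<in>I. y i * mat_vec I B x i) = (\<Sum>i\<in>I. \<Sum>j\<in>I. y i * (B i j * x j))"
    by (simp add: mat_vec_def sum_distrib_left)
  also have "\<dots> = (\<Sum>j\<in>I. \<Sum>i\<in>I. y i * (B i j * x j))"
    by (rule sum.swap)
  also have "\<dots> = (\<Sum>j\<in>I. x j * mat_vec I B y j)"
    unfolding mat_vec_def sum_distrib_left
    using assms by (intro sum.cong refl) (simp add: mult_ac)
  finally show ?thesis .
qed

lemma mat_vec_diff: "mat_vec I B (\<lambda>i. x i - y i) j = mat_vec I B x j - mat_vec I B y j"
  by (simp add: mat_vec_def sum_subtractf right_diff_distrib)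

text \<open>
  From \<open>0 \<le> B \<le> I\<close> as quadratic forms: expanding \<open>B\<close> at \<open>x - B x\<close>, which is nonnegative, gives
  \<open>2 \<parallel>B x\<parallel>\<^sup>2 \<le> x\<^sup>T B x + (B x)\<^sup>T B (B x) \<le> \<parallel>x\<parallel>\<^sup>2 + \<parallel>B x\<parallel>\<^sup>2\<close>.
\<close>

lemma sq_norm_mat_vec_le:
  assumes sym: "\<And>i j. i \<in> I \<Longrightarrow> j \<in> I \<Longrightarrow> B i j = B j i"
    and bd: "\<And>x. 0 \<le> quad_form I B x" "\<And>x. quad_form I B x \<le> sq_norm_on I x"
  shows "sq_norm_on I (mat_vec I B x) \<le> sq_norm_on I x"
proof -
  let ?y = "mat_vec I B x"
  have q: "quad_form I B x = (\<Sum>i\<in>I. x i * ?y i)"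
    by (rule quad_form_mat_vec)
  have "quad_form I B (\<lambda>i. x i - ?y i)
      = quad_form I B x - 2 * sq_norm_on I ?y + quad_form I B ?y"
    using bilinear_sym[OF sym, where x = x and y = ?y]
    by (simp add: quad_form_mat_vec mat_vec_diff algebra_simps sum.distrib sum_subtractf
        sq_norm_on_def power2_eq_square sum_distrib_left)
  then have "2 * sq_norm_on I ?y \<le> quad_form I B x + quad_form I B ?y"
    using bd(1)[of "\<lambda>i. x i - ?y i"] by simp
  then show ?thesis
    using bd(2)[of x] bd(2)[of ?y] by simp
qed

text \<open>
  The powers inherit \<open>0 \<le> B\<^sup>n \<le> I\<close>: two steps of the exponent amount to replacing \<open>x\<close> by the shorter
  vector \<open>B x\<close>, so the induction goes in steps of two.
\<close>

lemma quad_form_mat_power_bounds: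
  assumes "finite I" and sym: "\<And>i j. i \<in> I \<Longrightarrow> j \<in> I \<Longrightarrow> B i j = B j i"
    and bd: "\<And>x. 0 \<le> quad_form I B x" "\<And>x. quad_form I B x \<le> sq_norm_on I x"
  shows "0 \<le> quad_form I (mat_power I B n) x \<and> quad_form I (mat_power I B n) x \<le> sq_norm_on I x"
proof (induction n arbitrary: x rule: nat_induct2)
  case (step n)
  have "sq_norm_on I (mat_vec I B x) \<le> sq_norm_on I x"
    by (rule sq_norm_mat_vec_le[OF sym bd])
  then show ?case
    using step[of "mat_vec I B x"]
    by (simp only: quad_form_mat_power_add2[OF assms(1) sym] add_2_eq_Suc') auto
qed (use assms in \<open>simp_all only: quad_form_mat_power_0 quad_form_mat_power_1 sq_norm_on_nonneg\<close>, simp_all)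

text \<open>
  Polarization: the form at \<open>e\<^sub>i \<plusminus> e\<^sub>j\<close> is nonnegative, hence
  \<open>2 \<bar>P\<^sub>i\<^sub>j\<bar> \<le> P\<^sub>i\<^sub>i + P\<^sub>j\<^sub>j \<le> 2\<close>.
\<close>

lemma mat_power_entry_bound:
  assumes "finite I" and sym: "\<And>i j. i \<in> I \<Longrightarrow> j \<in> I \<Longrightarrow> B i j = B j i"
    and bd: "\<And>x. 0 \<le> quad_form I B x" "\<And>x. quad_form I B x \<le> sq_norm_on I x"
    and ij: "i \<in> I" "j \<in> I"
  shows "\<bar>mat_power I B n i j\<bar> \<le> 1"
proof -
  define P where "P = mat_power I B n"
  have qb: "0 \<le> quad_form I P x" "quad_form I P x \<le> sq_norm_on I x" for x
    using quad_form_mat_power_bounds[OF assms(1) sym bd] by (auto simp: P_def)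
  have Psym: "P i j = P j i"
    unfolding P_def by (rule mat_power_sym[OF assms(1) sym ij])
  define e where "e l = (\<lambda>k. if k = l then 1 else 0 :: real)" for l :: 'a
  have norm_e: "sq_norm_on I (e l) = 1" if "l \<in> I" for l
    using that assms(1) by (simp add: sq_norm_on_def e_def if_distribR power2_eq_square mult_delta_left)
  have e_sum: "(\<Sum>k\<in>I. e l k * y k) = y l" if "l \<in> I" for l y
    using that assms(1) by (simp add: e_def mult_delta_left)
  have P_e: "mat_vec I P (e l) k = P k l" if "l \<in> I" for l k
    using e_sum[OF that, of "P k"] by (simp add: mat_vec_def mult.commute)
  have diag: "quad_form I P (e l) = P l l" if "l \<in> I" for l
    using that by (simp add: quad_form_mat_vec P_e e_sum)
  have q: "quad_form I P (\<lambda>k. e i k + c * e j k) = P i i + 2 * c * P i j + c\<^sup>2 * P j j" for c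
  proof -
    have "mat_vec I P (\<lambda>k. e i k + c * e j k) k = P k i + c * P k j" for k
      using P_e[OF ij(1), of k] P_e[OF ij(2), of k]
      by (simp add: mat_vec_def distrib_left sum.distrib mult.left_commute[of _ c] flip: sum_distrib_left)
    then have "quad_form I P (\<lambda>k. e i k + c * e j k)
        = (\<Sum>k\<in>I. e i k * (P k i + c * P k j)) + c * (\<Sum>k\<in>I. e j k * (P k i + c * P k j))"
      by (simp add: quad_form_mat_vec distrib_right sum.distrib sum_distrib_left mult.assoc)
    then show ?thesis
      using e_sum[OF ij(1), of "\<lambda>k. P k i + c * P k j"] e_sum[OF ij(2), of "\<lambda>k. P k i + c * P k j"] Psym
      by (simp add: power2_eq_square algebra_simps)
  qed
  show ?thesis
    using qb(1)[of "\<lambda>k. e i k + 1 * e j k"] qb(1)[of "\<lambda>k. e i k + (-1) * e j k"]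
      qb(2)[of "e i"] qb(2)[of "e j"] diag[OF ij(1)] diag[OF ij(2)] norm_e[OF ij(1)] norm_e[OF ij(2)]
    unfolding q by (simp add: P_def)
qed

text \<open>
  The root of \<open>I - N\<close> is the series \<open>\<Sum>\<^sub>n a\<^sub>n N\<^sup>n\<close> with the coefficients of \<open>\<surd>(1 - x)\<close>. It converges
  absolutely entry by entry, so Cauchy products are available and the square is read off from the
  convolution of the coefficients. It is positive semidefinite because all coefficients after the
  first are nonpositive and \<open>N\<^sup>n \<le> I\<close>, so the form is at least \<open>(\<Sum>\<^sub>n a\<^sub>n) \<parallel>x\<parallel>\<^sup>2 \<ge> 0\<close>.
\<close>

lemma contraction_sqrt_exists:
  assumes "finite I" and sym: "\<And>i j. i \<in> I \<Longrightarrow> j \<in> I \<Longrightarrow> N i j = N j i"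
    and bd: "\<And>x. 0 \<le> quad_form I N x" "\<And>x. quad_form I N x \<le> sq_norm_on I x"
  shows "\<exists>B. symmetric_psd_on I B \<and>
    (\<forall>i\<in>I. \<forall>j\<in>I. (\<Sum>k\<in>I. B i k * B k j) = (if i = j then 1 else 0) - N i j)"
proof -
  define B where "B i j = (\<Sum>n. sqrt_coeff n * mat_power I N n i j)" for i j
  have abs_sum: "summable (\<lambda>n. norm (sqrt_coeff n * mat_power I N n i j))" if "i \<in> I" "j \<in> I" for i j
    by (rule summable_comparison_test[OF _ summable_abs_sqrt_coeff])
       (use mat_power_entry_bound[OF assms that] in \<open>auto simp: abs_mult intro!: mult_left_le\<close>)
  have sums_B: "(\<lambda>n. sqrt_coeff n * mat_power I N n i j) sums B i j" if "i \<in> I" "j \<in> I" for i j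
    unfolding B_def by (rule summable_sums[OF summable_norm_cancel[OF abs_sum[OF that]]])
  have B_sym: "B i j = B j i" if "i \<in> I" "j \<in> I" for i j
    unfolding B_def using mat_power_sym[OF assms(1) sym that] by simp
  have B_psd: "0 \<le> quad_form I B x" for x
  proof -
    have "(\<lambda>n. \<Sum>i\<in>I. \<Sum>j\<in>I. x i * (sqrt_coeff n * mat_power I N n i j) * x j) sums quad_form I B x"
      unfolding quad_form_def by (intro sums_sum sums_mult2 sums_mult sums_B)
    also have "(\<lambda>n. \<Sum>i\<in>I. \<Sum>j\<in>I. x i * (sqrt_coeff n * mat_power I N n i j) * x j)
        = (\<lambda>n. sqrt_coeff n * quad_form I (mat_power I N n) x)"
      by (simp add: quad_form_def sum_distrib_left mult_ac)
    finally have s: "(\<lambda>n. sqrt_coeff n * quad_form I (mat_power I N n) x) sums quad_form I B x" .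
    have "(\<Sum>n. sqrt_coeff n) * sq_norm_on I x \<le> quad_form I B x"
    proof (rule sums_le[OF _ sums_mult2[OF summable_sums[OF summable_sqrt_coeff]] s])
      fix n
      show "sqrt_coeff n * sq_norm_on I x \<le> sqrt_coeff n * quad_form I (mat_power I N n) x"
      proof (cases n)
        case 0
        then show ?thesis using quad_form_mat_power_0[OF assms(1), of N x] by (simp del: mat_power.simps)
      next
        case (Suc m)
        then show ?thesis
          using quad_form_mat_power_bounds[OF assms, of n x] sqrt_coeff_nonpos[of m]
          by (intro mult_left_mono_neg) auto
      qed
    qed
    then show ?thesis
      using suminf_sqrt_coeff_nonneg sq_norm_on_nonneg[of I x]
      by (meson mult_nonneg_nonneg order_trans)
  qed
  have B_sq: "(\<Sum>k\<in>I. B i k * B k j) = (if i = j then 1 else 0) - N i j" if "i \<in> I" "j \<in> I" for i j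
  proof -
    let ?a = "\<lambda>n. sqrt_coeff n * mat_power I N n i j"
    have "(\<lambda>n. \<Sum>l\<le>n. (sqrt_coeff l * mat_power I N l i k) * (sqrt_coeff (n - l) * mat_power I N (n - l) k j))
        sums (B i k * B k j)" if "k \<in> I" for k
      unfolding B_def using \<open>i \<in> I\<close> \<open>j \<in> I\<close> that by (intro Cauchy_product_sums abs_sum)
    then have "(\<lambda>n. \<Sum>k\<in>I. \<Sum>l\<le>n. (sqrt_coeff l * mat_power I N l i k) * (sqrt_coeff (n - l) * mat_power I N (n - l) k j))
        sums (\<Sum>k\<in>I. B i k * B k j)"
      by (intro sums_sum)
    also have "(\<lambda>n. \<Sum>k\<in>I. \<Sum>l\<le>n. (sqrt_coeff l * mat_power I N l i k) * (sqrt_coeff (n - l) * mat_power I N (n - l) k j))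
        = (\<lambda>n. (if n = 0 then 1 else if n = 1 then - 1 else 0) * mat_power I N n i j)"
    proof
      fix n
      have "(\<Sum>k\<in>I. \<Sum>l\<le>n. (sqrt_coeff l * mat_power I N l i k) * (sqrt_coeff (n - l) * mat_power I N (n - l) k j))
          = (\<Sum>l\<le>n. \<Sum>k\<in>I. (sqrt_coeff l * mat_power I N l i k) * (sqrt_coeff (n - l) * mat_power I N (n - l) k j))"
        by (rule sum.swap)
      also have "\<dots> = (\<Sum>l\<le>n. sqrt_coeff l * sqrt_coeff (n - l) * mat_power I N (l + (n - l)) i j)"
        unfolding mat_power_add[OF assms(1) \<open>i \<in> I\<close>] sum_distrib_left
        by (intro sum.cong refl) (simp add: mult_ac)
      also have "\<dots> = (\<Sum>l\<le>n. sqrt_coeff l * sqrt_coeff (n - l)) * mat_power I N n i j"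
        by (simp add: sum_distrib_right)
      finally show "(\<Sum>k\<in>I. \<Sum>l\<le>n. (sqrt_coeff l * mat_power I N l i k) * (sqrt_coeff (n - l) * mat_power I N (n - l) k j))
          = (if n = 0 then 1 else if n = 1 then - 1 else 0) * mat_power I N n i j"
        unfolding sqrt_coeff_convolution .
    qed
    finally have s1: "(\<lambda>n. (if n = 0 then 1 else if n = 1 then - 1 else 0) * mat_power I N n i j)
        sums (\<Sum>k\<in>I. B i k * B k j)" .
    have "(\<lambda>n. (if n = 0 then 1 else if n = 1 then - 1 else 0) * mat_power I N n i j)
        sums (\<Sum>n\<in>{0,1}. (if n = 0 then 1 else if n = 1 then - 1 else 0) * mat_power I N n i j)"
      by (rule sums_finite) auto
    then have "(\<Sum>k\<in>I. B i k * B k j)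
        = (\<Sum>n\<in>{0,1}. (if n = 0 then 1 else if n = 1 then - 1 else 0) * mat_power I N n i j)"
      by (rule sums_unique2[OF s1])
    also have "\<dots> = (if i = j then 1 else 0) - N i j"
      using mat_power_1[OF assms(1) \<open>j \<in> I\<close>, of N i] by simp
    finally show ?thesis .
  qed
  show ?thesis
    using B_sym B_psd B_sq by (intro exI[of _ B]) (auto simp: symmetric_psd_on_def quad_form_def)
qed

text \<open>
  Scaling reduces to the previous lemma: for \<open>t\<close> above the sum of the absolute entries, \<open>S / t \<le> I\<close>.
\<close>

lemma psd_sqrt_exists:
  assumes "finite I" and S: "symmetric_psd_on I S"
  shows "\<exists>B. symmetric_psd_on I B \<and> (\<forall>i\<in>I. \<forall>j\<in>I. (\<Sum>k\<in>I. B i k * B k j) = S i j)"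
proof -
  (* The summand 1 keeps t positive when S vanishes. *)
  define t where "t = 1 + (\<Sum>i\<in>I. \<Sum>j\<in>I. \<bar>S i j\<bar>)"
  have t: "t > 0"
    unfolding t_def by (intro add_pos_nonneg sum_nonneg) auto
  have Snn: "0 \<le> quad_form I S x" for x
    using S by (simp add: symmetric_psd_on_def quad_form_def)
  have Sle: "quad_form I S x \<le> t * sq_norm_on I x" for x
  proof -
    have "quad_form I S x \<le> (\<Sum>i\<in>I. \<Sum>j\<in>I. \<bar>S i j\<bar> * sq_norm_on I x)"
      unfolding quad_form_def
    proof (intro sum_mono)
      fix i j assume ij: "i \<in> I" "j \<in> I"
      have le: "(x k)\<^sup>2 \<le> sq_norm_on I x" if "k \<in> I" for k
        unfolding sq_norm_on_def using that assms(1) by (intro member_le_sum) auto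
      have "\<bar>x i * x j\<bar> \<le> ((x i)\<^sup>2 + (x j)\<^sup>2) / 2"
        using sum_squares_bound[of "\<bar>x i\<bar>" "\<bar>x j\<bar>"] by (simp add: abs_mult)
      also have "\<dots> \<le> sq_norm_on I x"
        using le[OF ij(1)] le[OF ij(2)] by simp
      finally have "\<bar>S i j\<bar> * \<bar>x i * x j\<bar> \<le> \<bar>S i j\<bar> * sq_norm_on I x"
        by (rule mult_left_mono) simp
      moreover have "x i * S i j * x j \<le> \<bar>S i j\<bar> * \<bar>x i * x j\<bar>"
        by (metis abs_ge_self abs_mult mult.assoc mult.commute)
      ultimately show "x i * S i j * x j \<le> \<bar>S i j\<bar> * sq_norm_on I x" by linarith
    qed
    also have "\<dots> = (\<Sum>i\<in>I. \<Sum>j\<in>I. \<bar>S i j\<bar>) * sq_norm_on I x"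
      by (simp add: sum_distrib_right)
    also have "\<dots> \<le> t * sq_norm_on I x"
      using sq_norm_on_nonneg[of I x] by (intro mult_right_mono) (auto simp: t_def)
    finally show ?thesis .
  qed
  define N where "N i j = (if i = j then 1 else 0) - S i j / t" for i j
  have N_form: "quad_form I N x = sq_norm_on I x - quad_form I S x / t" for x
  proof -
    have "quad_form I N x = (\<Sum>i\<in>I. \<Sum>j\<in>I. (if i = j then x i * x j else 0) - x i * S i j * x j / t)"
      unfolding quad_form_def N_def by (intro sum.cong refl) (simp add: algebra_simps)
    then show ?thesis
      using assms(1)
      by (simp add: quad_form_def sq_norm_on_def sum_subtractf sum_divide_distrib power2_eq_square)
  qed
  obtain B where B: "symmetric_psd_on I B"
    "\<And>i j. i \<in> I \<Longrightarrow> j \<in> I \<Longrightarrow> (\<Sum>k\<in>I. B i k * B k j) = (if i = j then 1 else 0) - N i j"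
  proof -
    have "\<exists>B. symmetric_psd_on I B \<and>
      (\<forall>i\<in>I. \<forall>j\<in>I. (\<Sum>k\<in>I. B i k * B k j) = (if i = j then 1 else 0) - N i j)"
    proof (rule contraction_sqrt_exists[OF assms(1)])
      show "N i j = N j i" if "i \<in> I" "j \<in> I" for i j
        using S that by (simp add: N_def symmetric_psd_on_def)
      show "0 \<le> quad_form I N x" "quad_form I N x \<le> sq_norm_on I x" for x
        using Sle[of x] Snn[of x] t by (simp_all add: N_form field_simps)
    qed
    then show ?thesis using that by blast
  qed
  have "(\<Sum>k\<in>I. (sqrt t * B i k) * (sqrt t * B k j)) = S i j" if "i \<in> I" "j \<in> I" for i j
  proof -
    have "(\<Sum>k\<in>I. (sqrt t * B i k) * (sqrt t * B k j)) = (\<Sum>k\<in>I. (sqrt t * sqrt t) * (B i k * B k j))"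
      by (intro sum.cong refl) (simp only: mult_ac)
    also have "\<dots> = (\<Sum>k\<in>I. t * (B i k * B k j))"
      using t by simp
    also have "\<dots> = t * ((if i = j then 1 else 0) - N i j)"
      by (simp add: B(2)[OF that] flip: sum_distrib_left)
    also have "\<dots> = S i j"
      using t by (simp add: N_def)
    finally show ?thesis .
  qed
  moreover have "symmetric_psd_on I (\<lambda>i j. sqrt t * B i j)"
  proof -
    have "(\<Sum>i\<in>I. \<Sum>j\<in>I. x i * (sqrt t * B i j) * x j) = sqrt t * (\<Sum>i\<in>I. \<Sum>j\<in>I. x i * B i j * x j)" for x
      by (simp add: sum_distrib_left mult_ac)
    then show ?thesis
      using B(1) t by (auto simp: symmetric_psd_on_def)
  qed
  ultimately show ?thesis by blast
qed

text \<open>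
  The only property of the square root used in the tail bounds: \<open>\<parallel>S\<^sup>1\<^sup>/\<^sup>2 x\<parallel>\<^sup>2 = x\<^sup>T S x\<close>.
\<close>

lemma psd_sqrt_norm_square:
  assumes "finite I" and S: "symmetric_psd_on I S"
  shows "(psd_sqrt_norm I S x)\<^sup>2 = quad_form I S x"
proof -
  define B where "B = psd_sqrt I S"
  have B: "symmetric_psd_on I B" "\<And>i j. i \<in> I \<Longrightarrow> j \<in> I \<Longrightarrow> (\<Sum>k\<in>I. B i k * B k j) = S i j"
    using someI_ex[OF psd_sqrt_exists[OF assms]] unfolding B_def psd_sqrt_def by auto
  have "(psd_sqrt_norm I S x)\<^sup>2 = (\<Sum>k\<in>I. (\<Sum>i\<in>I. B k i * x i)\<^sup>2)"
    by (simp add: psd_sqrt_norm_def L2_set_def B_def sum_nonneg)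
  also have "\<dots> = (\<Sum>k\<in>I. (\<Sum>i\<in>I. B k i * x i) * (\<Sum>j\<in>I. B k j * x j))"
    by (simp only: power2_eq_square)
  also have "\<dots> = (\<Sum>k\<in>I. \<Sum>i\<in>I. \<Sum>j\<in>I. x i * (B i k * B k j) * x j)"
    unfolding sum_product
    using B(1) by (intro sum.cong refl) (simp add: symmetric_psd_on_def mult_ac)
  also have "\<dots> = (\<Sum>i\<in>I. \<Sum>k\<in>I. \<Sum>j\<in>I. x i * (B i k * B k j) * x j)"
    by (rule sum.swap)
  also have "\<dots> = (\<Sum>i\<in>I. \<Sum>j\<in>I. \<Sum>k\<in>I. x i * (B i k * B k j) * x j)"
    by (intro sum.cong refl sum.swap)
  also have "\<dots> = quad_form I S x"
    unfolding quad_form_def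
    by (intro sum.cong refl) (simp add: B(2) flip: sum_distrib_left sum_distrib_right)
  finally show ?thesis .
qed

section \<open>Second-order cone form of the bounding problem\<close>

lemma affine_form_const: "affine_form I (\<lambda>x. c)"
  unfolding affine_form_def by (intro exI[of _ "\<lambda>_. 0"] exI[of _ c]) simp

lemma affine_form_component:
  assumes "finite I" "i \<in> I"
  shows "affine_form I (\<lambda>x. x i)"
  unfolding affine_form_def
  using assms by (intro exI[of _ "\<lambda>j. if j = i then 1 else 0"] exI[of _ 0]) (simp add: mult_delta_left)

lemma affine_form_add:
  assumes "affine_form I g" "affine_form I h"
  shows "affine_form I (\<lambda>x. g x + h x)"
proof -
  obtain a b a' b' where "\<forall>x. g x = (\<Sum>i\<in>I. a i * x i) + b" "\<forall>x. h x = (\<Sum>i\<in>I. a' i * x i) + b'"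
    using assms unfolding affine_form_def by blast
  then show ?thesis unfolding affine_form_def
    by (intro exI[of _ "\<lambda>i. a i + a' i"] exI[of _ "b + b'"]) (simp add: distrib_right sum.distrib)
qed

lemma affine_form_cmult:
  assumes "affine_form I g"
  shows "affine_form I (\<lambda>x. c * g x)"
proof -
  obtain a b where "\<forall>x. g x = (\<Sum>i\<in>I. a i * x i) + b"
    using assms unfolding affine_form_def by blast
  then show ?thesis unfolding affine_form_def
    by (intro exI[of _ "\<lambda>i. c * a i"] exI[of _ "c * b"]) (simp add: distrib_left sum_distrib_left mult.assoc)
qed

lemma affine_form_diff:
  "affine_form I g \<Longrightarrow> affine_form I h \<Longrightarrow> affine_form I (\<lambda>x. g x - h x)"
  using affine_form_add[OF _ affine_form_cmult[of I h "-1"], of g] by simp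

lemma affine_form_multc: "affine_form I g \<Longrightarrow> affine_form I (\<lambda>x. g x * c)"
  using affine_form_cmult[of I g c] by (simp add: mult.commute)

lemma affine_form_divide: "affine_form I g \<Longrightarrow> affine_form I (\<lambda>x. g x / c)"
  using affine_form_multc[of I g "inverse c"] by (simp add: divide_inverse)

lemma affine_form_sum:
  "(\<And>i. i \<in> R \<Longrightarrow> affine_form I (g i)) \<Longrightarrow> affine_form I (\<lambda>x. \<Sum>i\<in>R. g i x)"
  by (induction R rule: infinite_finite_induct) (auto intro: affine_form_const affine_form_add)

lemmas affine_form_intros =
  affine_form_const affine_form_add affine_form_cmult affine_form_diff
  affine_form_multc affine_form_divide affine_form_sum

text \<open>
  The rows of a cone constraint may be indexed by any finite set, not just by an initial segment.
\<close>

lemma soc_constraintI: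
  assumes "finite R" and "\<And>r. r \<in> R \<Longrightarrow> affine_form I (y r)" and "affine_form I t"
  shows "soc_constraint I {x. L2_set (\<lambda>r. y r x) R \<le> t x}"
proof -
  obtain h where h: "bij_betw h {..<card R} R"
    using ex_bij_betw_nat_finite[OF assms(1)] atLeast0LessThan by metis
  have "L2_set (\<lambda>r. y r x) R = L2_set (\<lambda>n. y (h n) x) {..<card R}" for x
    unfolding L2_set_def using sum.reindex_bij_betw[OF h, of "\<lambda>r. (y r x)\<^sup>2"] by simp
  moreover have "affine_form I (y (h n))" if "n < card R" for n
    using assms(2) bij_betwE[OF h] that by blast
  ultimately show ?thesis
    unfolding soc_constraint_def using assms(3)
    by (intro exI[of _ "card R"] exI[of _ "\<lambda>n. y (h n)"] exI[of _ t]) auto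
qed

lemma linear_inequality_soc: "affine_form I t \<Longrightarrow> soc_constraint I {x. 0 \<le> t x}"
  using soc_constraintI[of "{}" I "\<lambda>_ _. 0" t] by simp

lemma soc_constraint_psd_sqrt_norm:
  assumes J: "finite J" "Some ` J \<subseteq> I" "finite I" and "0 \<le> c" and "affine_form I t"
  shows "soc_constraint I {x. c * psd_sqrt_norm J S (\<lambda>k. x (Some k)) \<le> t x}"
proof -
  have "c * psd_sqrt_norm J S (\<lambda>k. x (Some k)) = L2_set (\<lambda>i. c * (\<Sum>j\<in>J. psd_sqrt J S i j * x (Some j))) J" for x
    unfolding psd_sqrt_norm_def using \<open>0 \<le> c\<close> by (rule L2_set_right_distrib)
  then show ?thesis
    using assms by (auto intro!: soc_constraintI affine_form_intros affine_form_component)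
qed

lemma ub_is_socp:
  fixes A :: "'s::finite \<Rightarrow> 'a set"
  assumes fin: "finite (state_actions A)"
    and V0: "\<And>\<rho>. V0 \<rho> = psd_sqrt_norm (state_actions A) S0 \<rho>" and f0: "0 \<le> f0 p0"
    and Vd: "\<And>j \<rho>. j \<in> {1..K} \<Longrightarrow> Vd j \<rho> = psd_sqrt_norm (state_actions A) (Sd j) \<rho>"
    and fd: "\<And>j. j \<in> {1..K} \<Longrightarrow> 0 \<le> fd j p1"
  shows "is_socp_pair (state_actions A)
           (ub_feasible A \<alpha> \<gamma> K \<xi> p0 p1 \<mu> cl cu dl du \<zeta>l f0 V0 fd Vd)"
proof -
  let ?J = "state_actions A" and ?I = "insert None (Some ` state_actions A)"
  let ?\<rho> = "\<lambda>x k. x (Some k)"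
  define C0 where "C0 = {x. f0 p0 * V0 (?\<rho> x) \<le> residual A \<alpha> cl cu \<zeta>l (x None) (?\<rho> x)}"
  define Cd where "Cd j = {x::('s \<times> 'a) option \<Rightarrow> real.
    fd j p1 * Vd j (?\<rho> x) \<le> residual A \<alpha> (dl j) (du j) \<zeta>l (\<xi> j) (?\<rho> x)}" for j
  define Cn where "Cn k = {x::('s \<times> 'a) option \<Rightarrow> real. 0 \<le> x (Some k)}" for k
  define Ce where "Ce s' = {x. (\<Sum>k\<in>?J. x (Some k) * ((if s' = fst k then 1 else 0) - \<alpha> * \<mu> k s'))
      - (1 - \<alpha>) * (\<gamma> $ s') = 0}" for s'
  have comp: "affine_form ?I (\<lambda>x. x None)" "\<And>k. k \<in> ?J \<Longrightarrow> affine_form ?I (\<lambda>x. x (Some k))"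
    using fin by (auto intro!: affine_form_component)
  have C0: "soc_constraint ?I C0"
    unfolding C0_def V0 residual_def using fin f0
    by (intro soc_constraint_psd_sqrt_norm affine_form_intros comp) auto
  have Cd: "soc_constraint ?I (Cd j)" if "j \<in> {1..K}" for j
    unfolding Cd_def Vd[OF that] residual_def using fin fd[OF that]
    by (intro soc_constraint_psd_sqrt_norm affine_form_intros comp) auto
  have Cn: "soc_constraint ?I (Cn k)" if "k \<in> ?J" for k
    unfolding Cn_def by (intro linear_inequality_soc comp that)
  have Ce: "linear_equality ?I (Ce s')" for s'
    unfolding linear_equality_def Ce_def
    by (rule exI, rule conjI[OF _ refl]) (intro affine_form_intros comp)
  let ?CC = "insert C0 (Cd ` {1..K} \<union> Cn ` ?J \<union> range Ce)"
  have "{x. (x None, ?\<rho> x) \<in> ub_feasible A \<alpha> \<gamma> K \<xi> p0 p1 \<mu> cl cu dl du \<zeta>l f0 V0 fd Vd} = \<Inter>?CC"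
  proof -
    have "{x. (x None, ?\<rho> x) \<in> ub_feasible A \<alpha> \<gamma> K \<xi> p0 p1 \<mu> cl cu dl du \<zeta>l f0 V0 fd Vd}
        = C0 \<inter> ((\<Inter>j\<in>{1..K}. Cd j) \<inter> (\<Inter>k\<in>?J. Cn k) \<inter> (\<Inter>s'. Ce s'))"
      by (auto simp: ub_feasible_def occupation_polytope_def C0_def Cd_def Cn_def Ce_def)
    also have "\<dots> = \<Inter>?CC" by blast
    finally show ?thesis .
  qed
  moreover have "linear_form ?I (\<lambda>x. x None)"
    unfolding linear_form_def using fin
    by (intro exI[of _ "\<lambda>i. if i = None then 1 else 0"]) (simp add: mult_delta_left)
  moreover have "finite ?I" "finite ?CC"
    using fin by auto
  moreover have "\<forall>C\<in>?CC. soc_constraint ?I C \<or> linear_equality ?I C"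
    using C0 Cd Cn Ce by blast
  ultimately show ?thesis
    unfolding is_socp_pair_def is_socp_def by blast
qed

section \<open>One-sided tail bounds\<close>

context prob_space
begin

text \<open>
  Cantelli's inequality \<open>P(X > t) \<le> v\<^sup>2 / (v\<^sup>2 + t\<^sup>2)\<close>, solved for the threshold. It is Markov's
  inequality for \<open>(X + u)\<^sup>2\<close> with the optimal shift \<open>u = v\<^sup>2 / t\<close>. For \<open>v = 0\<close> the shift degenerates, but
  then \<open>X = 0\<close> almost surely.
\<close>

lemma cantelli_tail:
  fixes X :: "'a \<Rightarrow> real"
  assumes int: "integrable M X" "integrable M (\<lambda>\<omega>. (X \<omega>)\<^sup>2)" and mean: "expectation X = 0"
    and v: "v\<^sup>2 = expectation (\<lambda>\<omega>. (X \<omega>)\<^sup>2)" "0 \<le> v"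
    and q: "0 < q" "q < 1" and t: "sqrt (q / (1 - q)) * v \<le> t"
  shows "q \<le> prob {\<omega> \<in> space M. X \<omega> \<le> t}"
proof (cases "v = 0")
  case True
  then have "AE \<omega> in M. (X \<omega>)\<^sup>2 = 0"
    using v integral_nonneg_eq_0_iff_AE[OF int(2)] by simp
  then have "AE \<omega> in M. X \<omega> \<le> t"
    using t True by (auto elim!: eventually_mono)
  then have "prob {\<omega> \<in> space M. X \<omega> \<le> t} = 1"
    using int(1) by (intro prob_eq_1[THEN iffD2]) auto
  then show ?thesis using q by simp
next
  case False
  have [measurable]: "X \<in> borel_measurable M" using int(1) by auto
  have v0: "0 < v" using False v(2) by simp
  have "0 < sqrt (q / (1 - q)) * v"
    using q v0 by simp
  then have t0: "0 < t" using t by simp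
  have "(sqrt (q / (1 - q)) * v)\<^sup>2 \<le> t\<^sup>2"
    using t q v0 by (intro power_mono) auto
  then have qt: "q * v\<^sup>2 \<le> (1 - q) * t\<^sup>2"
    using q by (simp add: power_mult_distrib field_simps)
  define u where "u = v\<^sup>2 / t"
  have u0: "0 < u" using v0 t0 by (simp add: u_def)
  have sq: "(\<lambda>\<omega>. (X \<omega> + u)\<^sup>2) = (\<lambda>\<omega>. (X \<omega>)\<^sup>2 + 2 * u * X \<omega> + u\<^sup>2)"
    by (auto simp: power2_sum)
  have int_sq: "integrable M (\<lambda>\<omega>. (X \<omega> + u)\<^sup>2)"
    unfolding sq using int by simp
  have E: "expectation (\<lambda>\<omega>. (X \<omega> + u)\<^sup>2) = v\<^sup>2 + u\<^sup>2"
    unfolding sq using int mean v(1) by (simp add: prob_space)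
  have "prob {\<omega> \<in> space M. t < X \<omega>} \<le> prob {\<omega> \<in> space M. (t + u)\<^sup>2 \<le> (X \<omega> + u)\<^sup>2}"
    using t0 u0 by (intro finite_measure_mono) (auto intro!: power_mono)
  also have "\<dots> \<le> expectation (\<lambda>\<omega>. (X \<omega> + u)\<^sup>2) / (t + u)\<^sup>2"
    using int_sq t0 u0 by (intro integral_Markov_inequality_measure[where A = "{}"]) auto
  also have "\<dots> = v\<^sup>2 / (v\<^sup>2 + t\<^sup>2)"
  proof -
    have a: "v\<^sup>2 + u\<^sup>2 = v\<^sup>2 * (v\<^sup>2 + t\<^sup>2) / t\<^sup>2" and b: "(t + u)\<^sup>2 = (v\<^sup>2 + t\<^sup>2)\<^sup>2 / t\<^sup>2"
      using t0 by (simp_all add: u_def field_simps power2_eq_square)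
    have "v\<^sup>2 + t\<^sup>2 > 0" using v0 t0 by (simp add: add_pos_pos)
    then show ?thesis unfolding E a b using t0 by (simp add: power2_eq_square)
  qed
  also have "\<dots> \<le> 1 - q"
  proof -
    have "v\<^sup>2 + t\<^sup>2 > 0" using v0 t0 by (simp add: add_pos_pos)
    moreover have "v\<^sup>2 \<le> (1 - q) * (v\<^sup>2 + t\<^sup>2)"
      using qt by (simp add: algebra_simps)
    ultimately show ?thesis by (simp only: pos_divide_le_eq)
  qed
  finally have "prob {\<omega> \<in> space M. t < X \<omega>} \<le> 1 - q" .
  moreover have "{\<omega> \<in> space M. t < X \<omega>} = space M - {\<omega> \<in> space M. X \<omega> \<le> t}" by auto
  ultimately show ?thesis
    by (simp add: prob_compl)
qed

text \<open>
  Hoeffding's inequality solved for the threshold. When all intervals are points (\<open>v = 0\<close>) it gives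
  nothing, but then every \<open>X i\<close> is constant and hence equal to its mean \<open>0\<close>.
\<close>

lemma hoeffding_tail:
  fixes X :: "'i \<Rightarrow> 'a \<Rightarrow> real"
  assumes fin: "finite I" and indep: "indep_vars (\<lambda>_. borel) X I"
    and bd: "\<And>i \<omega>. i \<in> I \<Longrightarrow> \<omega> \<in> space M \<Longrightarrow> a i \<le> X i \<omega> \<and> X i \<omega> \<le> b i"
    and mean: "\<And>i. i \<in> I \<Longrightarrow> expectation (X i) = 0"
    and v: "v\<^sup>2 = (\<Sum>i\<in>I. (b i - a i)\<^sup>2)" "0 \<le> v"
    and q: "0 < q" "q < 1" and t: "sqrt (- (1/2) * ln (1 - q)) * v \<le> t"
  shows "q \<le> prob {\<omega> \<in> space M. (\<Sum>i\<in>I. X i \<omega>) \<le> t}"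
proof -
  have ln: "ln (1 - q) < 0" using q by simp
  interpret H: Hoeffding_ineq M I X a b "\<Sum>i\<in>I. expectation (X i)"
    by unfold_locales (use fin indep bd in auto)
  have rv: "random_variable borel (\<lambda>\<omega>. \<Sum>i\<in>I. X i \<omega>)"
    using H.random_variable by (intro borel_measurable_sum) auto
  show ?thesis
  proof (cases "v = 0")
    case True
    then have "\<forall>i\<in>I. (b i - a i)\<^sup>2 = 0"
      using v fin by (subst sum_nonneg_eq_0_iff[symmetric]) auto
    then have ab: "X i \<omega> = a i" if "i \<in> I" "\<omega> \<in> space M" for i \<omega>
      using bd[OF that] that(1) by auto
    have "a i = 0" if "i \<in> I" for i
    proof -
      have "expectation (X i) = expectation (\<lambda>_. a i)"
        by (rule Bochner_Integration.integral_cong) (use ab that in auto)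
      then show ?thesis using mean[OF that] by (simp add: prob_space)
    qed
    then have "{\<omega> \<in> space M. (\<Sum>i\<in>I. X i \<omega>) \<le> t} = space M"
      using ab t True by auto
    then show ?thesis using q by (simp add: prob_space)
  next
    case False
    then have v0: "0 < v" using v(2) by simp
    have t0: "0 \<le> t" using t ln v0 by (meson mult_nonneg_nonneg less_imp_le order_trans real_sqrt_ge_zero
        mult_nonpos_nonpos neg_le_0_iff_le zero_le_divide_1_iff zero_le_numeral)
    have "(sqrt (- (1/2) * ln (1 - q)) * v)\<^sup>2 \<le> t\<^sup>2"
      using t ln v0 by (intro power_mono) auto
    then have "- (1/2) * ln (1 - q) * v\<^sup>2 \<le> t\<^sup>2"
      using ln by (simp add: power_mult_distrib)
    then have le: "-2 * t\<^sup>2 / v\<^sup>2 \<le> ln (1 - q)"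
      using v0 by (simp add: field_simps)
    have "prob {\<omega> \<in> space M. t < (\<Sum>i\<in>I. X i \<omega>)}
        \<le> prob {\<omega> \<in> space M. (\<Sum>i\<in>I. expectation (X i)) + t \<le> (\<Sum>i\<in>I. X i \<omega>)}"
      using rv mean by (intro finite_measure_mono) auto
    also have "\<dots> \<le> exp (-2 * t\<^sup>2 / v\<^sup>2)"
      using H.Hoeffding_ineq_ge[OF t0] v0 unfolding v(1)[symmetric] by simp
    also have "\<dots> \<le> exp (ln (1 - q))"
      using le by simp
    also have "\<dots> = 1 - q" using q by simp
    finally have "prob {\<omega> \<in> space M. t < (\<Sum>i\<in>I. X i \<omega>)} \<le> 1 - q" .
    moreover have "{\<omega> \<in> space M. t < (\<Sum>i\<in>I. X i \<omega>)} = space M - {\<omega> \<in> space M. (\<Sum>i\<in>I. X i \<omega>) \<le> t}" by auto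
    ultimately show ?thesis
      using rv by (simp add: prob_compl)
  qed
qed

text \<open>
  The union bound with the failure probability \<open>e\<close> split evenly. For empty \<open>J\<close> the quotient
  \<open>e / 0\<close> does no harm, as the event is the whole space.
\<close>

lemma prob_ball_ge:
  assumes fin: "finite J" and meas: "\<And>j. j \<in> J \<Longrightarrow> {\<omega> \<in> space M. Q j \<omega>} \<in> events"
    and ge: "\<And>j. j \<in> J \<Longrightarrow> 1 - e / real (card J) \<le> prob {\<omega> \<in> space M. Q j \<omega>}" and e: "0 \<le> e"
  shows "1 - e \<le> prob {\<omega> \<in> space M. \<forall>j\<in>J. Q j \<omega>}"
proof -
  have compl: "prob (space M - {\<omega> \<in> space M. Q j \<omega>}) \<le> e / real (card J)" if "j \<in> J" for j
    using ge[OF that] prob_compl[OF meas[OF that]] by simp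
  have "prob (\<Union>j\<in>J. space M - {\<omega> \<in> space M. Q j \<omega>}) \<le> (\<Sum>j\<in>J. prob (space M - {\<omega> \<in> space M. Q j \<omega>}))"
    using meas fin by (intro finite_measure_subadditive_finite) auto
  also have "\<dots> \<le> real (card J) * (e / real (card J))"
    using compl by (rule sum_bounded_above)
  also have "\<dots> \<le> e"
    using e by (cases "card J = 0") auto
  finally have "prob (\<Union>j\<in>J. space M - {\<omega> \<in> space M. Q j \<omega>}) \<le> e" .
  moreover have "(\<Union>j\<in>J. space M - {\<omega> \<in> space M. Q j \<omega>}) = space M - {\<omega> \<in> space M. \<forall>j\<in>J. Q j \<omega>}"
    by auto
  moreover have "{\<omega> \<in> space M. \<forall>j\<in>J. Q j \<omega>} \<in> events"
    using meas fin by (intro sets.sets_Collect_finite_All) auto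
  ultimately show ?thesis by (simp add: prob_compl)
qed

end

section \<open>Discounted cost of a policy at one outcome\<close>

definition stochastic_matrix :: "real^'s^'s \<Rightarrow> bool" where
  "stochastic_matrix P \<longleftrightarrow> (\<forall>s. prob_dist_on UNIV (\<lambda>s'. P $ s $ s'))"

lemma stochastic_policy_matrix:
  fixes A :: "'s::finite \<Rightarrow> 'a set"
  assumes f: "f \<in> stationary_policies A"
    and P: "\<And>k. k \<in> state_actions A \<Longrightarrow> prob_dist_on UNIV (P k)"
  shows "stochastic_matrix (policy_matrix A f P)"
  unfolding stochastic_matrix_def prob_dist_on_def
proof (intro allI conjI ballI)
  fix s s'
  show "0 \<le> policy_matrix A f P $ s $ s'"
    using f P by (auto simp: policy_matrix_def stationary_policies_def prob_dist_on_def state_actions_def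
        intro!: sum_nonneg mult_nonneg_nonneg)
  have "(\<Sum>s'\<in>UNIV. policy_matrix A f P $ s $ s') = (\<Sum>a\<in>A s. \<Sum>s'\<in>UNIV. f s a * P (s, a) s')"
    unfolding policy_matrix_def by (simp add: sum.swap[of _ "A s"])
  also have "\<dots> = (\<Sum>a\<in>A s. f s a)"
    using P by (intro sum.cong) (auto simp: prob_dist_on_def state_actions_def simp flip: sum_distrib_left)
  also have "\<dots> = 1"
    using f by (auto simp: stationary_policies_def prob_dist_on_def)
  finally show "(\<Sum>s'\<in>UNIV. policy_matrix A f P $ s $ s') = 1" .
qed

text \<open>
  At a state where \<open>V\<close> attains its maximum \<open>m\<close> the hypothesis gives \<open>m \<le> H + \<alpha> m\<close>, since averaging
  cannot exceed \<open>m\<close>; inserting \<open>m \<le> H / (1 - \<alpha>)\<close> once more keeps the statewise term \<open>h s\<close>. With an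
  inequality in \<open>V\<close> rather than an equation the lemma also shows that the resolvent has trivial kernel.
\<close>

lemma stochastic_fixpoint_le:
  fixes P :: "real^'s::finite^'s"
  assumes P: "stochastic_matrix P" and \<alpha>: "0 \<le> \<alpha>" "\<alpha> < 1"
    and V: "\<And>s. V s \<le> h s + \<alpha> * (\<Sum>s'\<in>UNIV. P $ s $ s' * V s')" and h: "\<And>s. h s \<le> H"
  shows "V s \<le> h s + \<alpha> / (1 - \<alpha>) * H"
proof -
  define m where "m = Max (range V)"
  have Vm: "V s \<le> m" for s unfolding m_def by simp
  have avg: "(\<Sum>s'\<in>UNIV. P $ s $ s' * V s') \<le> m" for s
  proof -
    have "(\<Sum>s'\<in>UNIV. P $ s $ s' * V s') \<le> (\<Sum>s'\<in>UNIV. P $ s $ s' * m)"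
      using P Vm by (intro sum_mono mult_left_mono) (auto simp: stochastic_matrix_def prob_dist_on_def)
    also have "\<dots> = m"
      using P by (simp add: stochastic_matrix_def prob_dist_on_def flip: sum_distrib_right)
    finally show ?thesis .
  qed
  have "m \<in> range V" unfolding m_def by (rule Max_in) auto
  then obtain s0 where "m = V s0" by blast
  then have "m \<le> H + \<alpha> * m"
    using V[of s0] h[of s0] mult_left_mono[OF avg[of s0] \<alpha>(1)] by simp
  then have "m \<le> H / (1 - \<alpha>)"
    using \<alpha> by (simp add: field_simps)
  then have "\<alpha> * m \<le> \<alpha> / (1 - \<alpha>) * H"
    using mult_left_mono[of m "H / (1 - \<alpha>)" \<alpha>] \<alpha>(1) by simp
  then show ?thesis
    using V[of s] mult_left_mono[OF avg[of s] \<alpha>(1)] by simp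
qed

lemma resolvent_mult:
  fixes P :: "real^'s::finite^'s"
  shows "((mat 1 - \<alpha> *\<^sub>R P) *v x) $ s = x $ s - \<alpha> * (\<Sum>s'\<in>UNIV. P $ s $ s' * x $ s')"
  by (simp add: matrix_vector_mult_def mat_def left_diff_distrib sum_subtractf mult_delta_left
      sum_distrib_left mult.assoc)

lemma resolvent_invertible:
  fixes P :: "real^'s::finite^'s"
  assumes P: "stochastic_matrix P" and \<alpha>: "0 \<le> \<alpha>" "\<alpha> < 1"
  shows "invertible (mat 1 - \<alpha> *\<^sub>R P)"
  unfolding invertible_left_inverse matrix_left_invertible_ker
proof (intro allI impI)
  fix x assume "(mat 1 - \<alpha> *\<^sub>R P) *v x = 0"
  then have x: "x $ s = \<alpha> * (\<Sum>s'\<in>UNIV. P $ s $ s' * x $ s')" for s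
    using resolvent_mult[of \<alpha> P x s] by simp
  have "x $ s \<le> 0 + \<alpha> / (1 - \<alpha>) * 0" for s
    by (rule stochastic_fixpoint_le[OF P \<alpha>, where h = "\<lambda>_. 0" and V = "\<lambda>s. x $ s"]) (simp_all flip: x)
  moreover have "- (x $ s) \<le> 0 + \<alpha> / (1 - \<alpha>) * 0" for s
    by (rule stochastic_fixpoint_le[OF P \<alpha>, where h = "\<lambda>_. 0" and V = "\<lambda>s. - (x $ s)"])
       (simp_all add: sum_negf flip: x)
  ultimately show "x = 0"
    by (simp add: vec_eq_iff order_antisym)
qed

definition policy_value ::
  "('s::finite \<Rightarrow> 'a set) \<Rightarrow> real \<Rightarrow> ('s \<Rightarrow> 'a \<Rightarrow> real) \<Rightarrow>
   ('s \<times> 'a \<Rightarrow> 's \<Rightarrow> real) \<Rightarrow> ('s \<times> 'a \<Rightarrow> real) \<Rightarrow> real^'s" where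
  "policy_value A \<alpha> f P g = matrix_inv (mat 1 - \<alpha> *\<^sub>R policy_matrix A f P) *v policy_cost A f g"

lemma policy_value_solves:
  assumes "invertible (mat 1 - \<alpha> *\<^sub>R policy_matrix A f P)"
  shows "(mat 1 - \<alpha> *\<^sub>R policy_matrix A f P) *v policy_value A \<alpha> f P g = policy_cost A f g"
proof -
  let ?R = "mat 1 - \<alpha> *\<^sub>R policy_matrix A f P"
  have "?R ** matrix_inv ?R = mat 1"
    using someI_ex[OF assms[unfolded invertible_def]] unfolding matrix_inv_def by blast
  then show ?thesis
    by (simp add: policy_value_def matrix_vector_mul_assoc)
qed

text \<open>
  The shift by \<open>W s0\<close> is invisible to a perturbation of total mass zero, and the omitted summand
  \<open>s' = s0\<close> has weight zero.
\<close>

lemma shifted_sum_zero_sum: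
  fixes W :: "'s::finite \<Rightarrow> real"
  assumes "(\<Sum>s'\<in>UNIV. y s') = 0"
  shows "shifted_sum W s0 y = (\<Sum>s'\<in>UNIV. W s' * y s')"
proof -
  have "shifted_sum W s0 y = (\<Sum>s'\<in>UNIV. (W s' - W s0) * y s')"
    unfolding shifted_sum_def by (intro sum.mono_neutral_left) auto
  also have "\<dots> = (\<Sum>s'\<in>UNIV. W s' * y s')"
    using assms by (simp add: left_diff_distrib sum_subtractf flip: sum_distrib_left)
  finally show ?thesis .
qed

locale discounted_mdp =
  fixes A :: "'s::finite \<Rightarrow> 'a set" and \<alpha> :: real
  assumes finite_actions: "\<And>s. finite (A s)" and actions_nonempty: "\<And>s. A s \<noteq> {}"
    and \<alpha>_pos: "0 < \<alpha>" and \<alpha>_less_1: "\<alpha> < 1"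
begin

lemma finite_state_actions: "finite (state_actions A)"
  unfolding state_actions_def using finite_actions by (intro finite_SigmaI) auto

lemma sum_state_actions: "(\<Sum>k\<in>state_actions A. F k) = (\<Sum>s\<in>UNIV. \<Sum>a\<in>A s. F (s, a))"
  unfolding state_actions_def using finite_actions by (subst sum.Sigma) auto

lemma bellman:
  assumes f: "f \<in> stationary_policies A"
    and P: "\<And>k. k \<in> state_actions A \<Longrightarrow> prob_dist_on UNIV (P k)"
  shows "policy_value A \<alpha> f P g $ s
    = (\<Sum>a\<in>A s. f s a * g (s, a)) + \<alpha> * (\<Sum>s'\<in>UNIV. policy_matrix A f P $ s $ s' * policy_value A \<alpha> f P g $ s')"
proof -
  have "invertible (mat 1 - \<alpha> *\<^sub>R policy_matrix A f P)"
    using \<alpha>_pos \<alpha>_less_1 by (intro resolvent_invertible stochastic_policy_matrix f P) auto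
  from policy_value_solves[OF this, of g]
  have "((mat 1 - \<alpha> *\<^sub>R policy_matrix A f P) *v policy_value A \<alpha> f P g) $ s = policy_cost A f g $ s"
    by simp
  then show ?thesis
    by (simp add: resolvent_mult policy_cost_def)
qed

lemma policy_average_le:
  assumes f: "f \<in> stationary_policies A" and h: "\<And>a. a \<in> A s \<Longrightarrow> h a \<le> c"
  shows "(\<Sum>a\<in>A s. f s a * h a) \<le> c"
proof -
  have "(\<Sum>a\<in>A s. f s a * h a) \<le> (\<Sum>a\<in>A s. f s a * c)"
    using f h by (intro sum_mono mult_left_mono) (auto simp: stationary_policies_def prob_dist_on_def)
  also have "\<dots> = c"
    using f by (simp add: stationary_policies_def prob_dist_on_def flip: sum_distrib_right)
  finally show ?thesis .
qed

text \<open>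
  The two summands of \<open>C\<^sub>m\<^sub>a\<^sub>x\<close> bound the cost of the current step, by the actions of the state \<open>s\<close>
  alone, and all later costs, by the overall maximum.
\<close>

lemma policy_value_le_cost_max:
  assumes f: "f \<in> stationary_policies A"
    and P: "\<And>k. k \<in> state_actions A \<Longrightarrow> prob_dist_on UNIV (P k)"
    and g: "\<And>k. k \<in> state_actions A \<Longrightarrow> g k \<le> u k"
  shows "policy_value A \<alpha> f P g $ s \<le> cost_max A \<alpha> u s"
proof -
  let ?V = "policy_value A \<alpha> f P g"
  let ?h = "\<lambda>s. \<Sum>a\<in>A s. f s a * g (s, a)"
  have "u (s, a) \<le> Max (u ` state_actions A)" if "a \<in> A s" for s a
    using that finite_state_actions by (intro Max_ge) (auto simp: state_actions_def)
  then have "?h s \<le> Max (u ` state_actions A)" for s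
    using f g by (intro policy_average_le) (force simp: state_actions_def)+
  then have "?V $ s \<le> ?h s + \<alpha> / (1 - \<alpha>) * Max (u ` state_actions A)"
    using bellman[OF f P] \<alpha>_pos \<alpha>_less_1
    by (intro stochastic_fixpoint_le[OF stochastic_policy_matrix[OF f P], where V = "\<lambda>s. ?V $ s" and h = ?h])
       auto
  moreover have "?h s \<le> Max ((\<lambda>a. u (s, a)) ` A s)"
  proof (rule policy_average_le[OF f])
    fix a assume a: "a \<in> A s"
    have "g (s, a) \<le> u (s, a)" using g a by (auto simp: state_actions_def)
    also have "\<dots> \<le> Max ((\<lambda>a. u (s, a)) ` A s)"
      using a finite_actions by (intro Max_ge) auto
    finally show "g (s, a) \<le> Max ((\<lambda>a. u (s, a)) ` A s)" .
  qed
  ultimately show ?thesis unfolding cost_max_def by simp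
qed

text \<open>
  Negating the costs exchanges the two bounds, so the lower bound on the value needs no proof of its own.
\<close>

lemma cost_max_uminus: "cost_max A \<alpha> (\<lambda>k. - l k) s = - cost_min A \<alpha> l s"
proof -
  have "state_actions A \<noteq> {}"
    using actions_nonempty by (auto simp: state_actions_def)
  then have global: "Max ((\<lambda>k. - l k) ` state_actions A) = - Min (l ` state_actions A)"
    using minus_Min_eq_Max[of "l ` state_actions A"] finite_state_actions by (simp add: image_image)
  have local: "Max ((\<lambda>a. - l (s, a)) ` A s) = - Min ((\<lambda>a. l (s, a)) ` A s)"
    using minus_Min_eq_Max[of "(\<lambda>a. l (s, a)) ` A s"] finite_actions actions_nonempty
    by (simp add: image_image)
  show ?thesis
    unfolding cost_max_def cost_min_def global local by (simp only: mult_minus_right minus_add_distrib)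
qed

lemma policy_value_uminus: "policy_value A \<alpha> f P (\<lambda>k. - g k) = - policy_value A \<alpha> f P g"
proof -
  have "policy_cost A f (\<lambda>k. - g k) = - policy_cost A f g"
    by (simp add: policy_cost_def vec_eq_iff sum_negf)
  then show ?thesis
    by (simp add: policy_value_def matrix_vector_mult_def vec_eq_iff sum_negf)
qed

lemma cost_min_le_policy_value:
  assumes f: "f \<in> stationary_policies A"
    and P: "\<And>k. k \<in> state_actions A \<Longrightarrow> prob_dist_on UNIV (P k)"
    and g: "\<And>k. k \<in> state_actions A \<Longrightarrow> l k \<le> g k"
  shows "cost_min A \<alpha> l s \<le> policy_value A \<alpha> f P g $ s"
  using policy_value_le_cost_max[OF f P, where g = "\<lambda>k. - g k" and u = "\<lambda>k. - l k" and s = s] g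
  by (simp add: cost_max_uminus policy_value_uminus)

text \<open>
  The policy is \<open>\<rho>\<close> conditioned on the state. At a state of mass zero every choice of \<open>f\<close> satisfies the
  product formula, since \<open>\<rho>\<close> vanishes there; the uniform distribution is taken.
\<close>

lemma occupation_disintegration:
  assumes \<rho>: "\<And>k. k \<in> state_actions A \<Longrightarrow> 0 \<le> \<rho> k"
  obtains f where "f \<in> stationary_policies A"
    and "\<And>s a. a \<in> A s \<Longrightarrow> (\<Sum>a'\<in>A s. \<rho> (s, a')) * f s a = \<rho> (s, a)"
proof
  let ?r = "\<lambda>s. \<Sum>a'\<in>A s. \<rho> (s, a')"
  let ?f = "\<lambda>s a. if ?r s = 0 then 1 / real (card (A s)) else \<rho> (s, a) / ?r s"
  have r: "0 \<le> ?r s" for s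
    using \<rho> by (intro sum_nonneg) (auto simp: state_actions_def)
  show "?f \<in> stationary_policies A"
    unfolding stationary_policies_def prob_dist_on_def
  proof (intro CollectI allI conjI ballI)
    fix s a assume "a \<in> A s"
    then show "0 \<le> ?f s a" using \<rho> r[of s] by (auto simp: state_actions_def intro!: divide_nonneg_nonneg)
  next
    fix s
    have "card (A s) \<noteq> 0" using finite_actions actions_nonempty by simp
    then show "(\<Sum>a\<in>A s. ?f s a) = 1"
      by (cases "?r s = 0") (simp_all flip: sum_divide_distrib)
  qed
  fix s a assume a: "a \<in> A s"
  show "?r s * ?f s a = \<rho> (s, a)"
  proof (cases "?r s = 0")
    case True
    then have "\<forall>a\<in>A s. \<rho> (s, a) = 0"
      using \<rho> finite_actions by (subst sum_nonneg_eq_0_iff[symmetric]) (auto simp: state_actions_def)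
    then show ?thesis using True a by simp
  qed simp
qed

text \<open>
  The defining equations of the polytope are paired with the value vector \<open>V\<close> of the perturbed law
  \<open>P\<close>, although they are written with \<open>\<mu>\<close>. The Bellman equation turns \<open>\<Sum>\<rho> V(s)\<close> into terms in \<open>P\<close>, and
  only the difference \<open>P - \<mu>\<close> survives.
\<close>

lemma discounted_cost_occupation:
  assumes f: "f \<in> stationary_policies A"
    and P: "\<And>k. k \<in> state_actions A \<Longrightarrow> prob_dist_on UNIV (P k)"
    and \<rho>: "\<rho> \<in> occupation_polytope A \<alpha> \<mu> \<gamma>"
    and fr: "\<And>s a. a \<in> A s \<Longrightarrow> (\<Sum>a'\<in>A s. \<rho> (s, a')) * f s a = \<rho> (s, a)"
  shows "discounted_cost A \<alpha> \<gamma> f P g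
    = (\<Sum>k\<in>state_actions A. \<rho> k * (g k + \<alpha> * (\<Sum>s'\<in>UNIV. (P k s' - \<mu> k s') * policy_value A \<alpha> f P g $ s')))"
proof -
  define V where "V s = policy_value A \<alpha> f P g $ s" for s
  let ?J = "state_actions A"
  have "discounted_cost A \<alpha> \<gamma> f P g = (\<Sum>s'\<in>UNIV. (1 - \<alpha>) * \<gamma> $ s' * V s')"
    by (simp add: discounted_cost_def V_def policy_value_def inner_vec_def sum_distrib_left mult.assoc)
  also have "\<dots> = (\<Sum>s'\<in>UNIV. (\<Sum>k\<in>?J. \<rho> k * ((if s' = fst k then 1 else 0) - \<alpha> * \<mu> k s')) * V s')"
    using \<rho> by (simp add: occupation_polytope_def)
  also have "\<dots> = (\<Sum>s'\<in>UNIV. \<Sum>k\<in>?J. \<rho> k * ((if s' = fst k then V s' else 0) - \<alpha> * (\<mu> k s' * V s')))"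
    unfolding sum_distrib_right by (intro sum.cong refl) (simp add: algebra_simps)
  also have "\<dots> = (\<Sum>k\<in>?J. \<Sum>s'\<in>UNIV. \<rho> k * ((if s' = fst k then V s' else 0) - \<alpha> * (\<mu> k s' * V s')))"
    by (rule sum.swap)
  also have "\<dots> = (\<Sum>k\<in>?J. \<rho> k * (V (fst k) - \<alpha> * (\<Sum>s'\<in>UNIV. \<mu> k s' * V s')))"
    by (simp add: sum_subtractf flip: sum_distrib_left)
  also have "\<dots> = (\<Sum>k\<in>?J. \<rho> k * V (fst k)) - (\<Sum>k\<in>?J. \<rho> k * (\<alpha> * (\<Sum>s'\<in>UNIV. \<mu> k s' * V s')))"
    by (simp add: right_diff_distrib sum_subtractf)
  also have "(\<Sum>k\<in>?J. \<rho> k * V (fst k)) = (\<Sum>k\<in>?J. \<rho> k * (g k + \<alpha> * (\<Sum>s'\<in>UNIV. P k s' * V s')))"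
  proof -
    have Vs: "V s = (\<Sum>a\<in>A s. f s a * (g (s, a) + \<alpha> * (\<Sum>s'\<in>UNIV. P (s, a) s' * V s')))" for s
    proof -
      have "(\<Sum>s'\<in>UNIV. policy_matrix A f P $ s $ s' * V s') = (\<Sum>s'\<in>UNIV. \<Sum>a\<in>A s. f s a * (P (s, a) s' * V s'))"
        by (simp add: policy_matrix_def sum_distrib_right mult.assoc)
      also have "\<dots> = (\<Sum>a\<in>A s. f s a * (\<Sum>s'\<in>UNIV. P (s, a) s' * V s'))"
        by (subst sum.swap) (simp add: sum_distrib_left)
      moreover have "V s = (\<Sum>a\<in>A s. f s a * g (s, a)) + \<alpha> * (\<Sum>s'\<in>UNIV. policy_matrix A f P $ s $ s' * V s')"
        unfolding V_def by (rule bellman[OF f P])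
      ultimately show ?thesis
        by (simp add: distrib_left sum.distrib sum_distrib_left mult.left_commute[of \<alpha>])
    qed
    have "(\<Sum>k\<in>?J. \<rho> k * V (fst k)) = (\<Sum>s\<in>UNIV. (\<Sum>a\<in>A s. \<rho> (s, a)) * V s)"
      by (simp add: sum_state_actions sum_distrib_right)
    also have "\<dots> = (\<Sum>s\<in>UNIV. \<Sum>a\<in>A s. \<rho> (s, a) * (g (s, a) + \<alpha> * (\<Sum>s'\<in>UNIV. P (s, a) s' * V s')))"
      by (subst Vs) (simp add: sum_distrib_left fr flip: mult.assoc cong: sum.cong)
    finally show ?thesis by (simp add: sum_state_actions)
  qed
  finally show ?thesis
    unfolding V_def[symmetric]
    by (simp only: left_diff_distrib sum_subtractf right_diff_distrib distrib_left add_diff_eq)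
qed

text \<open>
  The linearization. The product \<open>Z V\<close> is compared with \<open>Z C\<^sub>m\<^sub>a\<^sub>x\<close>; the gap \<open>- Z (C\<^sub>m\<^sub>a\<^sub>x - V)\<close> grows when
  \<open>Z\<close> is lowered to \<open>Zl\<close>, because \<open>V \<le> C\<^sub>m\<^sub>a\<^sub>x\<close>, and then when \<open>V\<close> is lowered to \<open>C\<^sub>m\<^sub>i\<^sub>n\<close>, because
  \<open>Zl \<le> 0\<close>. What remains random is linear in \<open>Z\<close>.
\<close>

lemma discounted_cost_le:
  assumes f: "f \<in> stationary_policies A"
    and P: "\<And>k. k \<in> state_actions A \<Longrightarrow> prob_dist_on UNIV (P k)"
    and \<mu>: "\<And>k. k \<in> state_actions A \<Longrightarrow> prob_dist_on UNIV (\<mu> k)"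
    and \<rho>: "\<rho> \<in> occupation_polytope A \<alpha> \<mu> \<gamma>"
    and fr: "\<And>s a. a \<in> A s \<Longrightarrow> (\<Sum>a'\<in>A s. \<rho> (s, a')) * f s a = \<rho> (s, a)"
    and g: "\<And>k. k \<in> state_actions A \<Longrightarrow> l k \<le> g k \<and> g k \<le> u k"
    and Z: "\<And>k s'. k \<in> state_actions A \<Longrightarrow> P k s' = \<mu> k s' + Z k s'"
    and Zl: "\<And>k s'. k \<in> state_actions A \<Longrightarrow> Zl k s' \<le> Z k s'"
    and Zl0: "\<And>k s'. k \<in> state_actions A \<Longrightarrow> Zl k s' \<le> 0"
    and le: "(\<Sum>k\<in>state_actions A. \<rho> k * shifted_sum (cost_max A \<alpha> u) s0 (Z k)) \<le> residual A \<alpha> l u Zl b \<rho>"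
  shows "discounted_cost A \<alpha> \<gamma> f P g \<le> b"
proof -
  let ?J = "state_actions A" and ?C = "cost_max A \<alpha> u" and ?c = "cost_min A \<alpha> l"
  define V where "V s = policy_value A \<alpha> f P g $ s" for s
  have VC: "V s \<le> ?C s" for s
    unfolding V_def using g by (intro policy_value_le_cost_max f P) auto
  have cV: "?c s \<le> V s" for s
    unfolding V_def using g by (intro cost_min_le_policy_value f P) auto
  have \<rho>0: "0 \<le> \<rho> k" if "k \<in> ?J" for k
    using \<rho> that by (simp add: occupation_polytope_def)
  have key: "(\<Sum>s'\<in>UNIV. Z k s' * V s') \<le> shifted_sum ?C s0 (Z k) - (\<Sum>s'\<in>UNIV. (?C s' - ?c s') * Zl k s')"
    if k: "k \<in> ?J" for k
  proof -
    have "(\<Sum>s'\<in>UNIV. Z k s') = (\<Sum>s'\<in>UNIV. P k s' - \<mu> k s')"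
      by (simp add: Z[OF k])
    also have "\<dots> = 0"
      using P[OF k] \<mu>[OF k] by (simp add: sum_subtractf prob_dist_on_def)
    finally have Z0: "(\<Sum>s'\<in>UNIV. Z k s') = 0" .
    have "Z k s' * V s' \<le> ?C s' * Z k s' - (?C s' - ?c s') * Zl k s'" for s'
    proof -
      have "(?C s' - V s') * Zl k s' \<le> (?C s' - V s') * Z k s'"
        using VC[of s'] Zl[OF k] by (intro mult_left_mono) auto
      moreover have "(?C s' - ?c s') * Zl k s' \<le> (?C s' - V s') * Zl k s'"
        using cV[of s'] Zl0[OF k] by (intro mult_right_mono_neg) auto
      ultimately show ?thesis by (simp add: algebra_simps)
    qed
    then have "(\<Sum>s'\<in>UNIV. Z k s' * V s') \<le> (\<Sum>s'\<in>UNIV. ?C s' * Z k s' - (?C s' - ?c s') * Zl k s')"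
      by (rule sum_mono)
    then show ?thesis
      by (simp add: shifted_sum_zero_sum[OF Z0] sum_subtractf)
  qed
  have "discounted_cost A \<alpha> \<gamma> f P g = (\<Sum>k\<in>?J. \<rho> k * (g k + \<alpha> * (\<Sum>s'\<in>UNIV. (P k s' - \<mu> k s') * V s')))"
    unfolding V_def by (rule discounted_cost_occupation[OF f P \<rho> fr])
  also have "\<dots> \<le> (\<Sum>k\<in>?J. \<rho> k * (u k + \<alpha> * (shifted_sum ?C s0 (Z k) - (\<Sum>s'\<in>UNIV. (?C s' - ?c s') * Zl k s'))))"
    using g key \<rho>0 Z \<alpha>_pos by (intro sum_mono mult_left_mono add_mono) auto
  also have "\<dots> = (\<Sum>k\<in>?J. \<rho> k * u k) + \<alpha> * (\<Sum>k\<in>?J. \<rho> k * shifted_sum ?C s0 (Z k))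
      - \<alpha> * (\<Sum>k\<in>?J. \<Sum>s'\<in>UNIV. \<rho> k * (?C s' - ?c s') * Zl k s')"
    by (simp add: distrib_left right_diff_distrib sum.distrib sum_subtractf sum_distrib_left mult_ac)
  also have "\<dots> \<le> b"
    using mult_left_mono[OF le, of \<alpha>] \<alpha>_pos by (simp add: residual_def)
  finally show ?thesis .
qed

text \<open>
  The matrix inverse is a choice without visible measurability, but by Cramer's rule the value is a
  quotient of determinants, which are polynomials in the random entries.
\<close>

lemma discounted_cost_measurable:
  assumes f: "f \<in> stationary_policies A"
    and p: "\<And>k s'. k \<in> state_actions A \<Longrightarrow> p k s' \<in> borel_measurable M"
    and pd: "\<And>k \<omega>. k \<in> state_actions A \<Longrightarrow> \<omega> \<in> space M \<Longrightarrow> prob_dist_on UNIV (\<lambda>s'. p k s' \<omega>)"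
    and g: "\<And>k. k \<in> state_actions A \<Longrightarrow> g k \<in> borel_measurable M"
  shows "(\<lambda>\<omega>. discounted_cost A \<alpha> \<gamma> f (\<lambda>k s'. p k s' \<omega>) (\<lambda>k. g k \<omega>)) \<in> borel_measurable M"
proof -
  define R where "R \<omega> = mat 1 - \<alpha> *\<^sub>R policy_matrix A f (\<lambda>k s'. p k s' \<omega>)" for \<omega>
  define h where "h \<omega> = policy_cost A f (\<lambda>k. g k \<omega>)" for \<omega>
  have R: "(\<lambda>\<omega>. R \<omega> $ i $ j) \<in> borel_measurable M" for i j
    unfolding R_def policy_matrix_def using p
    by (auto simp: state_actions_def intro!: borel_measurable_diff borel_measurable_times borel_measurable_sum)
  have h: "(\<lambda>\<omega>. h \<omega> $ i) \<in> borel_measurable M" for i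
    unfolding h_def policy_cost_def using g
    by (auto simp: state_actions_def intro!: borel_measurable_times borel_measurable_sum)
  have det_measurable: "(\<lambda>\<omega>. det (N \<omega>)) \<in> borel_measurable M"
    if "\<And>i j. (\<lambda>\<omega>. N \<omega> $ i $ j) \<in> borel_measurable M" for N :: "_ \<Rightarrow> real^'s^'s"
    unfolding det_def using that
    by (intro borel_measurable_sum borel_measurable_times borel_measurable_const borel_measurable_prod)
  have cram: "policy_value A \<alpha> f (\<lambda>k s'. p k s' \<omega>) (\<lambda>k. g k \<omega>)
      = (\<chi> k. det (\<chi> i j. if j = k then h \<omega> $ i else R \<omega> $ i $ j) / det (R \<omega>))" if "\<omega> \<in> space M" for \<omega>
  proof -
    have inv: "invertible (R \<omega>)"
      unfolding R_def using \<alpha>_pos \<alpha>_less_1 pd that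
      by (intro resolvent_invertible stochastic_policy_matrix f) auto
    then have "det (R \<omega>) \<noteq> 0" by (simp add: invertible_det_nz)
    from cramer[OF this] policy_value_solves[OF inv[unfolded R_def], of "\<lambda>k. g k \<omega>"]
    show ?thesis unfolding R_def h_def by blast
  qed
  have "(\<lambda>\<omega>. (1 - \<alpha>) * (\<Sum>k\<in>UNIV. \<gamma> $ k * (det (\<chi> i j. if j = k then h \<omega> $ i else R \<omega> $ i $ j) / det (R \<omega>))))
      \<in> borel_measurable M"
  proof (intro borel_measurable_times borel_measurable_sum borel_measurable_const borel_measurable_divide
      det_measurable R)
    fix k i j
    show "(\<lambda>\<omega>. (\<chi> i j. if j = k then h \<omega> $ i else R \<omega> $ i $ j) $ i $ j) \<in> borel_measurable M"
      by (cases "j = k") (simp_all add: R h)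
  qed
  then show ?thesis
    by (subst measurable_cong[where g = "\<lambda>\<omega>. (1 - \<alpha>) * (\<Sum>k\<in>UNIV. \<gamma> $ k * (det (\<chi> i j. if j = k then h \<omega> $ i else R \<omega> $ i $ j) / det (R \<omega>)))"])
       (simp_all add: discounted_cost_def cram[unfolded policy_value_def] inner_vec_def)
qed

end

section \<open>Tail bounds for the linear statistic\<close>

context prob_space
begin

text \<open>
  For centred variables the variance of a linear combination is the quadratic form of the covariance
  matrix. This links the norm in the cone constraint to Cantelli's inequality, and it also shows that
  the covariance matrix is positive semidefinite.
\<close>

lemma quad_form_covariance:
  assumes "finite I"
    and int: "\<And>i. i \<in> I \<Longrightarrow> integrable M (Y i)"
    and int2: "\<And>i j. i \<in> I \<Longrightarrow> j \<in> I \<Longrightarrow> integrable M (\<lambda>\<omega>. Y i \<omega> * Y j \<omega>)"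
    and mean: "\<And>i. i \<in> I \<Longrightarrow> expectation (Y i) = 0"
  shows "integrable M (\<lambda>\<omega>. (\<Sum>i\<in>I. x i * Y i \<omega>)\<^sup>2)"
    and "expectation (\<lambda>\<omega>. (\<Sum>i\<in>I. x i * Y i \<omega>)\<^sup>2) = quad_form I (covariance_matrix M Y) x"
proof -
  have sq: "(\<Sum>i\<in>I. x i * Y i \<omega>)\<^sup>2 = (\<Sum>i\<in>I. \<Sum>j\<in>I. x i * x j * (Y i \<omega> * Y j \<omega>))" for \<omega>
    unfolding power2_eq_square sum_product by (intro sum.cong refl) (simp only: mult_ac)
  show "integrable M (\<lambda>\<omega>. (\<Sum>i\<in>I. x i * Y i \<omega>)\<^sup>2)"
    unfolding sq using int2 by auto
  have "expectation (\<lambda>\<omega>. (\<Sum>i\<in>I. x i * Y i \<omega>)\<^sup>2)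
      = (\<Sum>i\<in>I. \<Sum>j\<in>I. x i * x j * expectation (\<lambda>\<omega>. Y i \<omega> * Y j \<omega>))"
    unfolding sq using int2 by (simp add: Bochner_Integration.integral_sum)
  also have "\<dots> = quad_form I (covariance_matrix M Y) x"
    unfolding quad_form_def covariance_matrix_def
    using mean by (intro sum.cong refl) simp
  finally show "expectation (\<lambda>\<omega>. (\<Sum>i\<in>I. x i * Y i \<omega>)\<^sup>2) = quad_form I (covariance_matrix M Y) x" .
qed

lemma cantelli_linear_combination:
  assumes "finite I"
    and int: "\<And>i. i \<in> I \<Longrightarrow> integrable M (Y i)"
    and int2: "\<And>i j. i \<in> I \<Longrightarrow> j \<in> I \<Longrightarrow> integrable M (\<lambda>\<omega>. Y i \<omega> * Y j \<omega>)"
    and mean: "\<And>i. i \<in> I \<Longrightarrow> expectation (Y i) = 0"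
    and q: "0 < q" "q < 1"
    and t: "sqrt (q / (1 - q)) * psd_sqrt_norm I (covariance_matrix M Y) x \<le> t"
  shows "q \<le> prob {\<omega> \<in> space M. (\<Sum>i\<in>I. x i * Y i \<omega>) \<le> t}"
proof (rule cantelli_tail[OF _ _ _ _ _ q t])
  have cov: "integrable M (\<lambda>\<omega>. (\<Sum>i\<in>I. y i * Y i \<omega>)\<^sup>2)"
    "expectation (\<lambda>\<omega>. (\<Sum>i\<in>I. y i * Y i \<omega>)\<^sup>2) = quad_form I (covariance_matrix M Y) y" for y
    by (intro quad_form_covariance assms(1) int int2 mean; assumption)+
  have "symmetric_psd_on I (covariance_matrix M Y)"
    unfolding symmetric_psd_on_def
  proof (intro conjI allI ballI)
    show "covariance_matrix M Y i j = covariance_matrix M Y j i" for i j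
      by (simp add: covariance_matrix_def mult.commute)
    show "0 \<le> (\<Sum>i\<in>I. \<Sum>j\<in>I. y i * covariance_matrix M Y i j * y j)" for y
      unfolding quad_form_def[symmetric] by (simp flip: cov(2))
  qed
  then show "(psd_sqrt_norm I (covariance_matrix M Y) x)\<^sup>2 = expectation (\<lambda>\<omega>. (\<Sum>i\<in>I. x i * Y i \<omega>)\<^sup>2)"
    by (simp add: psd_sqrt_norm_square[OF assms(1)] cov(2))
  show "0 \<le> psd_sqrt_norm I (covariance_matrix M Y) x"
    by (simp add: psd_sqrt_norm_def)
  show "integrable M (\<lambda>\<omega>. (\<Sum>i\<in>I. x i * Y i \<omega>)\<^sup>2)"
    by (rule cov(1))
  show "integrable M (\<lambda>\<omega>. \<Sum>i\<in>I. x i * Y i \<omega>)" "expectation (\<lambda>\<omega>. \<Sum>i\<in>I. x i * Y i \<omega>) = 0"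
    using int mean by (simp_all add: Bochner_Integration.integral_sum)
qed

end

lemma psd_sqrt_norm_diagonal_square:
  assumes "finite I"
  shows "(psd_sqrt_norm I (diagonal_matrix (\<lambda>i. (w i)\<^sup>2)) x)\<^sup>2 = (\<Sum>i\<in>I. (x i * w i)\<^sup>2)"
proof -
  have q: "quad_form I (diagonal_matrix (\<lambda>i. (w i)\<^sup>2)) y = (\<Sum>i\<in>I. (y i * w i)\<^sup>2)" for y
    using assms
    by (simp add: quad_form_def diagonal_matrix_def mult_delta_left mult_delta_right
        power2_eq_square mult_ac)
  have "symmetric_psd_on I (diagonal_matrix (\<lambda>i. (w i)\<^sup>2))"
    using q unfolding quad_form_def symmetric_psd_on_def
    by (auto simp: diagonal_matrix_def sum_nonneg)
  then show ?thesis
    by (simp add: psd_sqrt_norm_square[OF assms] q)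
qed

text \<open>
  This is where \<open>s0\<close> has to be a minimizer of \<open>W\<close>: the weights \<open>W s - W s0\<close> are then nonnegative.
\<close>

lemma shifted_sum_mono:
  assumes "\<And>s. W s0 \<le> W s" and "\<And>s. y s \<le> y' s"
  shows "shifted_sum W s0 y \<le> shifted_sum W s0 y'"
  unfolding shifted_sum_def using assms by (intro sum_mono mult_left_mono) auto

lemma shifted_sum_diff: "shifted_sum W s0 (\<lambda>s. y s - y' s) = shifted_sum W s0 y - shifted_sum W s0 y'"
  by (simp add: shifted_sum_def right_diff_distrib sum_subtractf)

context prob_space
begin

text \<open>
  The \<open>k\<close>-th summand lies in an interval of length \<open>x k * shifted_sum W s0 (Zu k - Zl k)\<close>, so the sum of
  the squared lengths is the squared norm \<open>\<parallel>D\<^sup>1\<^sup>/\<^sup>2 x\<parallel>\<^sup>2\<close> of the diagonal matrix in the constraint.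
\<close>

lemma hoeffding_shifted_sum:
  fixes Z :: "'i \<Rightarrow> 's::finite \<Rightarrow> 'a \<Rightarrow> real"
  assumes fin: "finite I"
    and indep: "indep_vars (\<lambda>_. borel) (\<lambda>k \<omega>. (\<chi> s. Z k s \<omega>) :: real^'s) I"
    and bd: "\<And>k s \<omega>. k \<in> I \<Longrightarrow> \<omega> \<in> space M \<Longrightarrow> Zl k s \<le> Z k s \<omega> \<and> Z k s \<omega> \<le> Zu k s"
    and mean: "\<And>k. k \<in> I \<Longrightarrow> expectation (\<lambda>\<omega>. shifted_sum W s0 (\<lambda>s. Z k s \<omega>)) = 0"
    and W: "\<And>s. W s0 \<le> W s" and x: "\<And>k. k \<in> I \<Longrightarrow> 0 \<le> x k"
    and q: "0 < q" "q < 1"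
    and t: "sqrt (- (1/2) * ln (1 - q)) * psd_sqrt_norm I
        (diagonal_matrix (\<lambda>k. (shifted_sum W s0 (\<lambda>s. Zu k s - Zl k s))\<^sup>2)) x \<le> t"
  shows "q \<le> prob {\<omega> \<in> space M. (\<Sum>k\<in>I. x k * shifted_sum W s0 (\<lambda>s. Z k s \<omega>)) \<le> t}"
proof (rule hoeffding_tail[OF fin _ _ _ _ _ q t])
  have "indep_vars (\<lambda>_. borel) (\<lambda>k \<omega>. x k * shifted_sum W s0 (\<lambda>s. ((\<chi> s. Z k s \<omega>) :: real^'s) $ s)) I"
    unfolding shifted_sum_def by (intro indep_vars_compose2[OF indep]) simp
  then show "indep_vars (\<lambda>_. borel) (\<lambda>k \<omega>. x k * shifted_sum W s0 (\<lambda>s. Z k s \<omega>)) I"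
    by simp
  show "x k * shifted_sum W s0 (Zl k) \<le> x k * shifted_sum W s0 (\<lambda>s. Z k s \<omega>) \<and>
      x k * shifted_sum W s0 (\<lambda>s. Z k s \<omega>) \<le> x k * shifted_sum W s0 (Zu k)"
    if "k \<in> I" "\<omega> \<in> space M" for k \<omega>
    using bd[OF that] x[OF that(1)] W by (intro conjI mult_left_mono shifted_sum_mono) auto
  show "expectation (\<lambda>\<omega>. x k * shifted_sum W s0 (\<lambda>s. Z k s \<omega>)) = 0" if "k \<in> I" for k
    using mean[OF that] by simp
  show "(psd_sqrt_norm I (diagonal_matrix (\<lambda>k. (shifted_sum W s0 (\<lambda>s. Zu k s - Zl k s))\<^sup>2)) x)\<^sup>2
      = (\<Sum>k\<in>I. (x k * shifted_sum W s0 (Zu k) - x k * shifted_sum W s0 (Zl k))\<^sup>2)"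
    unfolding psd_sqrt_norm_diagonal_square[OF fin] by (simp add: shifted_sum_diff right_diff_distrib)
  show "0 \<le> psd_sqrt_norm I (diagonal_matrix (\<lambda>k. (shifted_sum W s0 (\<lambda>s. Zu k s - Zl k s))\<^sup>2)) x"
    by (simp add: psd_sqrt_norm_def)
qed

end

section \<open>Chance constraints under random transitions\<close>

locale perturbed_mdp = prob_space M + discounted_mdp A \<alpha>
  for M :: "'w measure" and A :: "'s::finite \<Rightarrow> 'a set" and \<alpha> :: real +
  fixes p \<zeta> :: "'s \<times> 'a \<Rightarrow> 's \<Rightarrow> 'w \<Rightarrow> real" and \<mu> \<zeta>l \<zeta>u :: "'s \<times> 'a \<Rightarrow> 's \<Rightarrow> real"
  assumes p_measurable: "\<And>k s'. k \<in> state_actions A \<Longrightarrow> p k s' \<in> borel_measurable M"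
    and p_dist: "\<And>k \<omega>. k \<in> state_actions A \<Longrightarrow> \<omega> \<in> space M \<Longrightarrow> prob_dist_on UNIV (\<lambda>s'. p k s' \<omega>)"
    and \<mu>_dist: "\<And>k. k \<in> state_actions A \<Longrightarrow> prob_dist_on UNIV (\<mu> k)"
    and \<mu>_mean: "\<And>k s'. k \<in> state_actions A \<Longrightarrow> \<mu> k s' = expectation (p k s')"
    and p_decomp: "\<And>k s' \<omega>. k \<in> state_actions A \<Longrightarrow> \<omega> \<in> space M \<Longrightarrow> p k s' \<omega> = \<mu> k s' + \<zeta> k s' \<omega>"
    and \<zeta>_bounds: "\<And>k s' \<omega>. k \<in> state_actions A \<Longrightarrow> \<omega> \<in> space M \<Longrightarrow>
      \<zeta>l k s' \<le> \<zeta> k s' \<omega> \<and> \<zeta> k s' \<omega> \<le> \<zeta>u k s'"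
    and \<zeta>l_nonpos: "\<And>k s'. k \<in> state_actions A \<Longrightarrow> \<zeta>l k s' \<le> 0"
begin

lemma \<zeta>_measurable:
  assumes "k \<in> state_actions A"
  shows "\<zeta> k s' \<in> borel_measurable M"
proof -
  have "(\<lambda>\<omega>. p k s' \<omega> - \<mu> k s') \<in> borel_measurable M"
    using p_measurable[OF assms] by simp
  then show ?thesis
    by (subst measurable_cong[where g = "\<lambda>\<omega>. p k s' \<omega> - \<mu> k s'"]) (simp_all add: p_decomp[OF assms])
qed

lemma \<zeta>_integrable:
  assumes "k \<in> state_actions A"
  shows "integrable M (\<zeta> k s')"
proof (rule integrable_const_bound)
  show "AE \<omega> in M. norm (\<zeta> k s' \<omega>) \<le> \<bar>\<zeta>l k s'\<bar> + \<bar>\<zeta>u k s'\<bar>"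
    using \<zeta>_bounds[OF assms, of _ s'] by (intro AE_I2) (fastforce simp: abs_le_iff)
qed (rule \<zeta>_measurable[OF assms])

lemma expectation_\<zeta>:
  assumes "k \<in> state_actions A"
  shows "expectation (\<zeta> k s') = 0"
proof -
  have "\<mu> k s' = expectation (\<lambda>\<omega>. \<mu> k s' + \<zeta> k s' \<omega>)"
    unfolding \<mu>_mean[OF assms, of s', symmetric]
    using \<mu>_mean[OF assms, of s'] p_decomp[OF assms]
    by (simp cong: Bochner_Integration.integral_cong)
  also have "\<dots> = \<mu> k s' + expectation (\<zeta> k s')"
    using \<zeta>_integrable[OF assms] by (simp add: prob_space)
  finally show ?thesis by simp
qed

lemma shifted_sum_\<zeta>_integrable:
  "k \<in> state_actions A \<Longrightarrow> integrable M (\<lambda>\<omega>. shifted_sum W s0 (\<lambda>s'. \<zeta> k s' \<omega>))"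
  unfolding shifted_sum_def using \<zeta>_integrable by simp

lemma expectation_shifted_sum_\<zeta>:
  "k \<in> state_actions A \<Longrightarrow> expectation (\<lambda>\<omega>. shifted_sum W s0 (\<lambda>s'. \<zeta> k s' \<omega>)) = 0"
  unfolding shifted_sum_def using \<zeta>_integrable expectation_\<zeta>
  by (simp add: Bochner_Integration.integral_sum)

lemma shifted_sum_\<zeta>_product_integrable:
  assumes "k \<in> state_actions A" "k' \<in> state_actions A"
  shows "integrable M (\<lambda>\<omega>. shifted_sum W s0 (\<lambda>s'. \<zeta> k s' \<omega>) * shifted_sum W s0 (\<lambda>s'. \<zeta> k' s' \<omega>))"
proof -
  define B where "B k = (\<Sum>s'\<in>UNIV - {s0}. \<bar>W s' - W s0\<bar> * (\<bar>\<zeta>l k s'\<bar> + \<bar>\<zeta>u k s'\<bar>))" for k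
  have bd: "\<bar>shifted_sum W s0 (\<lambda>s'. \<zeta> k s' \<omega>)\<bar> \<le> B k" if "k \<in> state_actions A" "\<omega> \<in> space M" for k \<omega>
    unfolding shifted_sum_def B_def
  proof (rule order_trans[OF sum_abs sum_mono])
    fix s'
    have "\<bar>\<zeta> k s' \<omega>\<bar> \<le> \<bar>\<zeta>l k s'\<bar> + \<bar>\<zeta>u k s'\<bar>"
      using \<zeta>_bounds[OF that, of s'] by auto
    then show "\<bar>(W s' - W s0) * \<zeta> k s' \<omega>\<bar> \<le> \<bar>W s' - W s0\<bar> * (\<bar>\<zeta>l k s'\<bar> + \<bar>\<zeta>u k s'\<bar>)"
      unfolding abs_mult by (rule mult_left_mono) simp
  qed
  show ?thesis
  proof (rule integrable_const_bound)
    show "AE \<omega> in M. norm (shifted_sum W s0 (\<lambda>s'. \<zeta> k s' \<omega>) * shifted_sum W s0 (\<lambda>s'. \<zeta> k' s' \<omega>)) \<le> B k * B k'"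
    proof (rule AE_I2)
      fix \<omega> assume "\<omega> \<in> space M"
      note b = bd[OF assms(1) this] bd[OF assms(2) this]
      have "0 \<le> B k" using b(1) by linarith
      then show "norm (shifted_sum W s0 (\<lambda>s'. \<zeta> k s' \<omega>) * shifted_sum W s0 (\<lambda>s'. \<zeta> k' s' \<omega>)) \<le> B k * B k'"
        using b by (simp add: abs_mult mult_mono)
    qed
    show "(\<lambda>\<omega>. shifted_sum W s0 (\<lambda>s'. \<zeta> k s' \<omega>) * shifted_sum W s0 (\<lambda>s'. \<zeta> k' s' \<omega>)) \<in> borel_measurable M"
      using shifted_sum_\<zeta>_integrable assms by (intro borel_measurable_times) auto
  qed
qed

lemma covariance_tail:
  assumes "0 < q" "q < 1"
    and "sqrt (q / (1 - q)) * psd_sqrt_norm (state_actions A)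
      (covariance_matrix M (\<lambda>k \<omega>. shifted_sum W s0 (\<lambda>s'. \<zeta> k s' \<omega>))) \<rho> \<le> t"
  shows "q \<le> prob {\<omega> \<in> space M. (\<Sum>k\<in>state_actions A. \<rho> k * shifted_sum W s0 (\<lambda>s'. \<zeta> k s' \<omega>)) \<le> t}"
  using assms
  by (intro cantelli_linear_combination finite_state_actions shifted_sum_\<zeta>_integrable
      shifted_sum_\<zeta>_product_integrable expectation_shifted_sum_\<zeta>)

lemma independent_tail:
  assumes "indep_vars (\<lambda>_. borel) (\<lambda>k \<omega>. (\<chi> s'. \<zeta> k s' \<omega>) :: real^'s) (state_actions A)"
    and "\<And>s. W s0 \<le> W s" and "\<And>k. k \<in> state_actions A \<Longrightarrow> 0 \<le> \<rho> k"
    and "0 < q" "q < 1"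
    and "sqrt (- (1/2) * ln (1 - q)) * psd_sqrt_norm (state_actions A)
      (diagonal_matrix (\<lambda>k. (shifted_sum W s0 (\<lambda>s'. \<zeta>u k s' - \<zeta>l k s'))\<^sup>2)) \<rho> \<le> t"
  shows "q \<le> prob {\<omega> \<in> space M. (\<Sum>k\<in>state_actions A. \<rho> k * shifted_sum W s0 (\<lambda>s'. \<zeta> k s' \<omega>)) \<le> t}"
  using assms
  by (intro hoeffding_shifted_sum[where Zl = \<zeta>l and Zu = \<zeta>u]
      finite_state_actions \<zeta>_bounds expectation_shifted_sum_\<zeta>)

text \<open>
  A tail bound on the linear statistic passes to the cost by inclusion of events. Measurability of the
  larger event is part of the claim, because the measure of a nonmeasurable set is \<open>0\<close> by convention.
\<close>

lemma discounted_cost_tail: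
  assumes f: "f \<in> stationary_policies A"
    and \<rho>: "\<rho> \<in> occupation_polytope A \<alpha> \<mu> \<gamma>"
    and fr: "\<And>s a. a \<in> A s \<Longrightarrow> (\<Sum>a'\<in>A s. \<rho> (s, a')) * f s a = \<rho> (s, a)"
    and g: "\<And>k. k \<in> state_actions A \<Longrightarrow> g k \<in> borel_measurable M"
    and bd: "\<And>k \<omega>. k \<in> state_actions A \<Longrightarrow> \<omega> \<in> space M \<Longrightarrow> l k \<le> g k \<omega> \<and> g k \<omega> \<le> u k"
    and tail: "q \<le> prob {\<omega> \<in> space M.
      (\<Sum>k\<in>state_actions A. \<rho> k * shifted_sum (cost_max A \<alpha> u) s0 (\<lambda>s'. \<zeta> k s' \<omega>)) \<le> residual A \<alpha> l u \<zeta>l b \<rho>}"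
  shows "{\<omega> \<in> space M. discounted_cost A \<alpha> \<gamma> f (\<lambda>k s'. p k s' \<omega>) (\<lambda>k. g k \<omega>) \<le> b} \<in> events"
    and "q \<le> prob {\<omega> \<in> space M. discounted_cost A \<alpha> \<gamma> f (\<lambda>k s'. p k s' \<omega>) (\<lambda>k. g k \<omega>) \<le> b}"
proof -
  have "(\<lambda>\<omega>. discounted_cost A \<alpha> \<gamma> f (\<lambda>k s'. p k s' \<omega>) (\<lambda>k. g k \<omega>)) \<in> borel_measurable M"
    by (intro discounted_cost_measurable f p_measurable p_dist g)
  then show event: "{\<omega> \<in> space M. discounted_cost A \<alpha> \<gamma> f (\<lambda>k s'. p k s' \<omega>) (\<lambda>k. g k \<omega>) \<le> b} \<in> events"
    by simp
  note tail
  also have "prob {\<omega> \<in> space M.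
      (\<Sum>k\<in>state_actions A. \<rho> k * shifted_sum (cost_max A \<alpha> u) s0 (\<lambda>s'. \<zeta> k s' \<omega>)) \<le> residual A \<alpha> l u \<zeta>l b \<rho>}
    \<le> prob {\<omega> \<in> space M. discounted_cost A \<alpha> \<gamma> f (\<lambda>k s'. p k s' \<omega>) (\<lambda>k. g k \<omega>) \<le> b}"
  proof (rule finite_measure_mono[OF _ event], intro subsetI CollectI conjI)
    fix \<omega>
    assume \<omega>: "\<omega> \<in> {\<omega> \<in> space M.
      (\<Sum>k\<in>state_actions A. \<rho> k * shifted_sum (cost_max A \<alpha> u) s0 (\<lambda>s'. \<zeta> k s' \<omega>)) \<le> residual A \<alpha> l u \<zeta>l b \<rho>}"
    then show "\<omega> \<in> space M" by simp
    with \<omega> show "discounted_cost A \<alpha> \<gamma> f (\<lambda>k s'. p k s' \<omega>) (\<lambda>k. g k \<omega>) \<le> b"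
      using p_dist \<mu>_dist p_decomp \<zeta>_bounds \<zeta>l_nonpos bd
      by (intro discounted_cost_le[OF f _ _ \<rho> fr, where Z = "\<lambda>k s'. \<zeta> k s' \<omega>"]) auto
  qed
  finally show "q \<le> prob {\<omega> \<in> space M. discounted_cost A \<alpha> \<gamma> f (\<lambda>k s'. p k s' \<omega>) (\<lambda>k. g k \<omega>) \<le> b}" .
qed

end

section \<open>The conic upper bound\<close>

theorem theorem8:
  fixes M :: "'w measure"
    and A :: "'s::finite \<Rightarrow> 'a set"
    and \<alpha> p0 p1 :: real
    and \<gamma> :: "real^'s"
    and K :: nat
    and \<xi> :: "nat \<Rightarrow> real"
    and c :: "'s \<times> 'a \<Rightarrow> 'w \<Rightarrow> real"
    and d :: "nat \<Rightarrow> 's \<times> 'a \<Rightarrow> 'w \<Rightarrow> real"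
    and p \<zeta> :: "'s \<times> 'a \<Rightarrow> 's \<Rightarrow> 'w \<Rightarrow> real"
    and \<mu> \<zeta>l \<zeta>u :: "'s \<times> 'a \<Rightarrow> 's \<Rightarrow> real"
    and cl cu :: "'s \<times> 'a \<Rightarrow> real"
    and dl du :: "nat \<Rightarrow> 's \<times> 'a \<Rightarrow> real"
    and sc :: 's
    and sd :: "nat \<Rightarrow> 's"
    and f0 :: "real \<Rightarrow> real"
    and V0 :: "('s \<times> 'a \<Rightarrow> real) \<Rightarrow> real"
    and fd :: "nat \<Rightarrow> real \<Rightarrow> real"
    and Vd :: "nat \<Rightarrow> ('s \<times> 'a \<Rightarrow> real) \<Rightarrow> real"
  assumes "prob_space M"
    and "\<And>s. finite (A s)" and "\<And>s. A s \<noteq> {}"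
    and "0 < \<alpha>" and "\<alpha> < 1"
    and "0 < p0" and "p0 < 1" and "0 < p1" and "p1 < 1"
    and "prob_dist_on UNIV (\<lambda>s. \<gamma> $ s)"
    and "\<And>k. k \<in> state_actions A \<Longrightarrow> c k \<in> borel_measurable M"
    and "\<And>j k. j \<in> {1..K} \<Longrightarrow> k \<in> state_actions A \<Longrightarrow> d j k \<in> borel_measurable M"
    and "\<And>k s'. k \<in> state_actions A \<Longrightarrow> p k s' \<in> borel_measurable M"
    and "\<And>k \<omega>. k \<in> state_actions A \<Longrightarrow> \<omega> \<in> space M \<Longrightarrow> prob_dist_on UNIV (\<lambda>s'. p k s' \<omega>)"
    and "\<And>k. k \<in> state_actions A \<Longrightarrow> prob_dist_on UNIV (\<mu> k)"
    and "\<And>k s'. k \<in> state_actions A \<Longrightarrow> \<mu> k s' = integral\<^sup>L M (p k s')"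
    and "\<And>k s' \<omega>. k \<in> state_actions A \<Longrightarrow> \<omega> \<in> space M \<Longrightarrow> p k s' \<omega> = \<mu> k s' + \<zeta> k s' \<omega>"
    and "\<And>k \<omega>. k \<in> state_actions A \<Longrightarrow> \<omega> \<in> space M \<Longrightarrow> cl k \<le> c k \<omega> \<and> c k \<omega> \<le> cu k"
    and "\<And>j k \<omega>. j \<in> {1..K} \<Longrightarrow> k \<in> state_actions A \<Longrightarrow> \<omega> \<in> space M \<Longrightarrow>
           dl j k \<le> d j k \<omega> \<and> d j k \<omega> \<le> du j k"
    and "\<And>k s' \<omega>. k \<in> state_actions A \<Longrightarrow> \<omega> \<in> space M \<Longrightarrow>
           \<zeta>l k s' \<le> \<zeta> k s' \<omega> \<and> \<zeta> k s' \<omega> \<le> \<zeta>u k s'"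
    and "\<And>k s'. k \<in> state_actions A \<Longrightarrow> \<zeta>u k s' \<ge> 0"
    and "\<And>k s'. k \<in> state_actions A \<Longrightarrow> \<zeta>l k s' \<le> 0"
    and "is_arg_min (cost_max A \<alpha> cu) (\<lambda>_. True) sc"
    and "\<And>j. j \<in> {1..K} \<Longrightarrow> is_arg_min (cost_max A \<alpha> (du j)) (\<lambda>_. True) (sd j)"
    and "(f0 p0 = sqrt (p0 / (1 - p0)) \<and>
          (\<forall>\<rho>. V0 \<rho> = psd_sqrt_norm (state_actions A)
             (covariance_matrix M (\<lambda>k \<omega>. shifted_sum (cost_max A \<alpha> cu) sc (\<lambda>s'. \<zeta> k s' \<omega>))) \<rho>) \<and>
          (\<forall>j\<in>{1..K}. fd j p1 = sqrt ((real K - 1 + p1) / (1 - p1)) \<and>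
             (\<forall>\<rho>. Vd j \<rho> = psd_sqrt_norm (state_actions A)
                (covariance_matrix M
                   (\<lambda>k \<omega>. shifted_sum (cost_max A \<alpha> (du j)) (sd j) (\<lambda>s'. \<zeta> k s' \<omega>))) \<rho>)))
         \<or>
         (prob_space.indep_vars M (\<lambda>_. borel) (\<lambda>k \<omega>. (\<chi> s'. \<zeta> k s' \<omega>) :: real^'s) (state_actions A) \<and>
          f0 p0 = sqrt (- (1/2) * ln (1 - p0)) \<and>
          (\<forall>\<rho>. V0 \<rho> = psd_sqrt_norm (state_actions A)
             (diagonal_matrix
                (\<lambda>k. (shifted_sum (cost_max A \<alpha> cu) sc (\<lambda>s'. \<zeta>u k s' - \<zeta>l k s'))\<^sup>2)) \<rho>) \<and>
          (\<forall>j\<in>{1..K}. fd j p1 = sqrt (- (1/2) * ln ((1 - p1) / real K)) \<and>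
             (\<forall>\<rho>. Vd j \<rho> = psd_sqrt_norm (state_actions A)
                (diagonal_matrix
                   (\<lambda>k. (shifted_sum (cost_max A \<alpha> (du j)) (sd j) (\<lambda>s'. \<zeta>u k s' - \<zeta>l k s'))\<^sup>2)) \<rho>)))"
  shows "is_socp_pair (state_actions A)
           (ub_feasible A \<alpha> \<gamma> K \<xi> p0 p1 \<mu> cl cu dl du \<zeta>l f0 V0 fd Vd) \<and>
         opt_value fst (jccmdp_feasible M A \<alpha> \<gamma> K \<xi> p0 p1 c d p)
           \<le> opt_value fst (ub_feasible A \<alpha> \<gamma> K \<xi> p0 p1 \<mu> cl cu dl du \<zeta>l f0 V0 fd Vd)"
proof -
  interpret perturbed_mdp M A \<alpha> p \<zeta> \<mu> \<zeta>l \<zeta>u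
    using assms(1-5,13-17,20,22)
    by (intro perturbed_mdp.intro perturbed_mdp_axioms.intro discounted_mdp.intro)
  note p0 = assms(6,7) and p1 = assms(8,9) and cases = assms(25)
  have sc: "cost_max A \<alpha> cu sc \<le> cost_max A \<alpha> cu s" for s
    using assms(23) by (simp add: is_arg_min_linorder)
  have sd: "cost_max A \<alpha> (du j) (sd j) \<le> cost_max A \<alpha> (du j) s" if "j \<in> {1..K}" for j s
    using assms(24)[OF that] by (simp add: is_arg_min_linorder)
  let ?J = "state_actions A"
  let ?Yc = "\<lambda>k \<omega>. shifted_sum (cost_max A \<alpha> cu) sc (\<lambda>s'. \<zeta> k s' \<omega>)"
  let ?Yd = "\<lambda>j k \<omega>. shifted_sum (cost_max A \<alpha> (du j)) (sd j) (\<lambda>s'. \<zeta> k s' \<omega>)"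

  (* The level of each single constraint: the allowed failure probability 1 - p1, split K ways. *)
  define q where "q = 1 - (1 - p1) / real K"
  have q: "0 < q" "q < 1" "q / (1 - q) = (real K - 1 + p1) / (1 - p1)" "1 - q = (1 - p1) / real K"
    if "j \<in> {1..K}" for j
  proof -
    have K: "1 \<le> real K" using that by simp
    have "(1 - p1) / real K \<le> (1 - p1) / 1"
      using K p1 by (intro divide_left_mono) auto
    then show "0 < q" unfolding q_def using p1 by simp
    show "q < 1" unfolding q_def using K p1 by simp
    show "q / (1 - q) = (real K - 1 + p1) / (1 - p1)" "1 - q = (1 - p1) / real K"
      unfolding q_def using K p1 by (simp_all add: field_simps)
  qed

  (* All that the rest of the proof uses of either case: cone form of the left-hand sides, and tails. *)
  have tails: "\<exists>S0 Sd. (\<forall>\<rho>. V0 \<rho> = psd_sqrt_norm ?J S0 \<rho>) \<and> 0 \<le> f0 p0 \<and>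
      (\<forall>j\<in>{1..K}. \<forall>\<rho>. Vd j \<rho> = psd_sqrt_norm ?J (Sd j) \<rho>) \<and> (\<forall>j\<in>{1..K}. 0 \<le> fd j p1) \<and>
      (\<forall>\<rho> t. (\<forall>k\<in>?J. 0 \<le> \<rho> k) \<longrightarrow> f0 p0 * V0 \<rho> \<le> t \<longrightarrow>
        p0 \<le> prob {\<omega> \<in> space M. (\<Sum>k\<in>?J. \<rho> k * ?Yc k \<omega>) \<le> t}) \<and>
      (\<forall>j\<in>{1..K}. \<forall>\<rho> t. (\<forall>k\<in>?J. 0 \<le> \<rho> k) \<longrightarrow> fd j p1 * Vd j \<rho> \<le> t \<longrightarrow>
        q \<le> prob {\<omega> \<in> space M. (\<Sum>k\<in>?J. \<rho> k * ?Yd j k \<omega>) \<le> t})"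
    using cases
  proof (elim disjE conjE, goal_cases)
    case 1
    have fd: "fd j p1 = sqrt (q / (1 - q))" if "j \<in> {1..K}" for j
      using 1 that q(3)[OF that] by simp
    have Vd: "\<forall>\<rho>. Vd j \<rho> = psd_sqrt_norm ?J (covariance_matrix M (?Yd j)) \<rho>" if "j \<in> {1..K}" for j
      using 1 that by simp
    show ?case
    proof (intro exI[of _ "covariance_matrix M ?Yc"] exI[of _ "\<lambda>j. covariance_matrix M (?Yd j)"] conjI ballI allI impI)
      show "V0 \<rho> = psd_sqrt_norm ?J (covariance_matrix M ?Yc) \<rho>" for \<rho>
        using 1(2) by blast
      show "0 \<le> f0 p0" unfolding 1(1) using p0 by simp
      show "Vd j \<rho> = psd_sqrt_norm ?J (covariance_matrix M (?Yd j)) \<rho>" if "j \<in> {1..K}" for j \<rho>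
        using Vd[OF that] by blast
      show "0 \<le> fd j p1" if "j \<in> {1..K}" for j
        unfolding fd[OF that] using q(1,2)[OF that] by simp
      show "p0 \<le> prob {\<omega> \<in> space M. (\<Sum>k\<in>?J. \<rho> k * ?Yc k \<omega>) \<le> t}" if "f0 p0 * V0 \<rho> \<le> t" for \<rho> t
        using that 1(1,2) by (intro covariance_tail p0) simp
      show "q \<le> prob {\<omega> \<in> space M. (\<Sum>k\<in>?J. \<rho> k * ?Yd j k \<omega>) \<le> t}"
        if "j \<in> {1..K}" "fd j p1 * Vd j \<rho> \<le> t" for j \<rho> t
        using that(2) fd[OF that(1)] Vd[OF that(1)] by (intro covariance_tail q[OF that(1)]) simp
    qed
  next
    case 2
    let ?D = "\<lambda>W s0. diagonal_matrix (\<lambda>k. (shifted_sum W s0 (\<lambda>s'. \<zeta>u k s' - \<zeta>l k s'))\<^sup>2)"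
    let ?Dc = "?D (cost_max A \<alpha> cu) sc" and ?Dd = "\<lambda>j. ?D (cost_max A \<alpha> (du j)) (sd j)"
    have fd: "fd j p1 = sqrt (- (1/2) * ln (1 - q))" if "j \<in> {1..K}" for j
      using 2 that q(4)[OF that] by simp
    have Vd: "\<forall>\<rho>. Vd j \<rho> = psd_sqrt_norm ?J (?Dd j) \<rho>" if "j \<in> {1..K}" for j
      using 2 that by simp
    show ?case
    proof (intro exI[of _ ?Dc] exI[of _ ?Dd] conjI ballI allI impI)
      show "V0 \<rho> = psd_sqrt_norm ?J ?Dc \<rho>" for \<rho>
        using 2(3) by blast
      show "0 \<le> f0 p0" unfolding 2(2) using p0 by simp
      show "Vd j \<rho> = psd_sqrt_norm ?J (?Dd j) \<rho>" if "j \<in> {1..K}" for j \<rho>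
        using Vd[OF that] by blast
      show "0 \<le> fd j p1" if "j \<in> {1..K}" for j
        unfolding fd[OF that] using q(1,2)[OF that] by simp
      show "p0 \<le> prob {\<omega> \<in> space M. (\<Sum>k\<in>?J. \<rho> k * ?Yc k \<omega>) \<le> t}"
        if "\<forall>k\<in>?J. 0 \<le> \<rho> k" "f0 p0 * V0 \<rho> \<le> t" for \<rho> t
        using that 2(2,3) by (intro independent_tail[OF 2(1)] sc p0) simp_all
      show "q \<le> prob {\<omega> \<in> space M. (\<Sum>k\<in>?J. \<rho> k * ?Yd j k \<omega>) \<le> t}"
        if "j \<in> {1..K}" "\<forall>k\<in>?J. 0 \<le> \<rho> k" "fd j p1 * Vd j \<rho> \<le> t" for j \<rho> t
        using that(2,3) fd[OF that(1)] Vd[OF that(1)]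
        by (intro independent_tail[OF 2(1)] sd q[OF that(1)] that(1)) simp_all
    qed
  qed
  obtain S0 Sd where V0: "\<And>\<rho>. V0 \<rho> = psd_sqrt_norm ?J S0 \<rho>" and f0: "0 \<le> f0 p0"
    and Vd: "\<And>j \<rho>. j \<in> {1..K} \<Longrightarrow> Vd j \<rho> = psd_sqrt_norm ?J (Sd j) \<rho>"
    and fd: "\<And>j. j \<in> {1..K} \<Longrightarrow> 0 \<le> fd j p1"
    and tail0: "\<And>\<rho> t. (\<forall>k\<in>?J. 0 \<le> \<rho> k) \<Longrightarrow> f0 p0 * V0 \<rho> \<le> t \<Longrightarrow>
        p0 \<le> prob {\<omega> \<in> space M. (\<Sum>k\<in>?J. \<rho> k * ?Yc k \<omega>) \<le> t}"
    and taild: "\<And>j \<rho> t. j \<in> {1..K} \<Longrightarrow> (\<forall>k\<in>?J. 0 \<le> \<rho> k) \<Longrightarrow> fd j p1 * Vd j \<rho> \<le> t \<Longrightarrow>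
        q \<le> prob {\<omega> \<in> space M. (\<Sum>k\<in>?J. \<rho> k * ?Yd j k \<omega>) \<le> t}"
    using tails by (elim exE conjE) blast

  let ?UB = "ub_feasible A \<alpha> \<gamma> K \<xi> p0 p1 \<mu> cl cu dl du \<zeta>l f0 V0 fd Vd"
  have "is_socp_pair ?J ?UB"
    using finite_state_actions V0 f0 Vd fd by (rule ub_is_socp)
  moreover have "opt_value fst (jccmdp_feasible M A \<alpha> \<gamma> K \<xi> p0 p1 c d p) \<le> opt_value fst ?UB"
    unfolding opt_value_def
  proof (rule INF_mono)
    fix x assume "x \<in> ?UB"
    then obtain z \<rho> where x: "x = (z, \<rho>)" and zc: "f0 p0 * V0 \<rho> \<le> residual A \<alpha> cl cu \<zeta>l z \<rho>"
      and zd: "\<And>j. j \<in> {1..K} \<Longrightarrow> fd j p1 * Vd j \<rho> \<le> residual A \<alpha> (dl j) (du j) \<zeta>l (\<xi> j) \<rho>"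
      and \<rho>: "\<rho> \<in> occupation_polytope A \<alpha> \<mu> \<gamma>"
      unfolding ub_feasible_def by blast
    have \<rho>0: "\<forall>k\<in>?J. 0 \<le> \<rho> k"
      using \<rho> by (simp add: occupation_polytope_def)
    obtain f where f: "f \<in> stationary_policies A"
      and fr: "\<And>s a. a \<in> A s \<Longrightarrow> (\<Sum>a'\<in>A s. \<rho> (s, a')) * f s a = \<rho> (s, a)"
      using occupation_disintegration[of \<rho>] \<rho>0 by blast
    have "p0 \<le> prob {\<omega> \<in> space M. discounted_cost A \<alpha> \<gamma> f (\<lambda>k s'. p k s' \<omega>) (\<lambda>k. c k \<omega>) \<le> z}"
      by (rule discounted_cost_tail(2)[OF f \<rho> fr assms(11,18) tail0[OF \<rho>0 zc]])
    moreover have "1 - (1 - p1) \<le> prob {\<omega> \<in> space M. \<forall>j\<in>{1..K}.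
        discounted_cost A \<alpha> \<gamma> f (\<lambda>k s'. p k s' \<omega>) (\<lambda>k. d j k \<omega>) \<le> \<xi> j}"
    proof (rule prob_ball_ge)
      fix j assume j: "j \<in> {1..K}"
      note D = discounted_cost_tail[OF f \<rho> fr assms(12,19)[OF j] taild[OF j \<rho>0 zd[OF j]]]
      show "{\<omega> \<in> space M. discounted_cost A \<alpha> \<gamma> f (\<lambda>k s'. p k s' \<omega>) (\<lambda>k. d j k \<omega>) \<le> \<xi> j} \<in> events"
        by (rule D(1))
      show "1 - (1 - p1) / real (card {1..K})
          \<le> prob {\<omega> \<in> space M. discounted_cost A \<alpha> \<gamma> f (\<lambda>k s'. p k s' \<omega>) (\<lambda>k. d j k \<omega>) \<le> \<xi> j}"
        using D(2) by (simp add: q_def)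
    qed (use p1 in auto)
    ultimately have "(z, f) \<in> jccmdp_feasible M A \<alpha> \<gamma> K \<xi> p0 p1 c d p"
      using f by (simp add: jccmdp_feasible_def)
    then show "\<exists>y\<in>jccmdp_feasible M A \<alpha> \<gamma> K \<xi> p0 p1 c d p. ereal (fst y) \<le> ereal (fst x)"
      unfolding x by (intro bexI[of _ "(z, f)"]) auto
  qed
  ultimately show ?thesis ..
qed

end
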